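(* Let $1\leq p<\infty$, $-1/p\leq\lambda<0$ and $-Q<\alpha<\infty$. Then there is a constant $C>0$, independent of $f$, $\Phi$ and $A$, such that $$\Vert\mathcal{H}_{\Phi,A}f\Vert_{\dot{L}^{p,\lambda}(\mathbb{H}^n;|\cdot|_h^{\alpha})}\leq C\,C_3(\alpha)\,\Vert f\Vert_{\dot{L}^{p,\lambda}(\mathbb{H}^n;|\cdot|_h^{\alpha})},$$ where $$C_3(\alpha)=\begin{cases}\displaystyle\int_{\mathbb{H}^n}\frac{|\Phi(y)|}{|y|_h^{Q}}\,\frac{\Vert A(y)\Vert^{(Q+\alpha)(\lambda+1/p)}}{|\det A(y)|^{1/p}}\,\Vert A^{-1}(y)\Vert^{\alpha/p}\,dy, & 0<\alpha<\infty,\\[2ex]\displaystyle\int_{\mathbb{H}^n}\frac{|\Phi(y)|}{|y|_h^{Q}}\,\frac{\Vert A(y)\Vert^{(Q+\alpha)(\lambda+1/p)}}{|\det A(y)|^{1/p}}\,\Vert A(y)\Vert^{-\alpha/p}\,dy, & -Q<\alpha\leq0.\end{cases}$$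
   Context: The Heisenberg group $\mathbb{H}^n$ is $\mathbf{R}^{2n}\times\mathbf{R}$ with group law $x\cdot y=\big(x_1+y_1,\dots,x_{2n}+y_{2n},\,x_{2n+1}+y_{2n+1}+2\sum_{j=1}^n(y_jx_{n+j}-x_jy_{n+j})\big)$; the inverse of $x$ is $-x$; Haar measure is Lebesgue measure $dx$. $Q=2n+2$ is the homogeneous dimension. The norm is $|x|_h=\big[(\sum_{i=1}^{2n}x_i^2)^2+x_{2n+1}^2\big]^{1/4}$, the distance is $d(p,q)=|q^{-1}p|_h$, and $B(x,r)=\{y: d(x,y)<r\}$. For a $(2n+1)\times(2n+1)$ real matrix $M$ (acting on $\mathbf{R}^{2n+1}$), $\Vert M\Vert=\sup_{x\in\mathbb{H}^n,\,x\neq0}|Mx|_h/|x|_h$. $A^{-1}(y)$ denotes the inverse matrix of $A(y)$. $\Phi$ is a locally integrable function on $\mathbb{H}^n$, and $A(y)$ is a function on $\mathbb{H}^n$ with values in $(2n+1)\times(2n+1)$ matrices with $\det A(y)\neq0$ for almost every $y$ in the support of $\Phi$. The Hausdorff operator is $\mathcal{H}_{\Phi,A}f(x)=\int_{\mathbb{H}^n}\frac{\Phi(y)}{|y|_h^Q}f(A(y)x)\,dy$. For a weight $w$ (a nonnegative locally integrable function on $\mathbb{H}^n$; here $w(x)=|x|_h^\alpha$), put $w(E)=\int_E w(x)\,dx$. For $1\leq p<\infty$ and $-1/p\leq\lambda<0$, the weighted central Morrey space $\dot{L}^{p,\lambda}(\mathbb{H}^n;w)$ consists of $f\in L^p_{loc}(\mathbb{H}^n;w)$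 with $\Vert f\Vert_{\dot{L}^{p,\lambda}(\mathbb{H}^n;w)}=\sup_{r>0}\left(\frac{1}{w(B(0,r))^{1+p\lambda}}\int_{B(0,r)}|f(x)|^pw(x)\,dx\right)^{1/p}<\infty$. *)

theory Defs
  imports "HOL-Analysis.Analysis"
begin

section \<open>The Heisenberg group\<close>

text \<open>
  The underlying set is $\mathbf{R}^{2n+1}$ with $n$ the cardinality of the finite type \<open>'n\<close>.
  The index \<open>Inl j\<close> stands for the coordinate $x_j$, \<open>Inr (Inl j)\<close> for $x_{n+j}$ and
  \<open>Inr (Inr ())\<close> for the central coordinate $x_{2n+1}$. Topology and Haar measure are those
  of the Euclidean space.
\<close>

type_synonym 'n hidx = "'n + 'n + unit"
type_synonym 'n heis = "(real, 'n hidx) vec"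
type_synonym 'n hmat = "((real, 'n hidx) vec, 'n hidx) vec"

abbreviation xcoord :: "'n::finite heis \<Rightarrow> 'n \<Rightarrow> real" where
  "xcoord x j \<equiv> x $ Inl j"

abbreviation ycoord :: "'n::finite heis \<Rightarrow> 'n \<Rightarrow> real" where
  "ycoord x j \<equiv> x $ Inr (Inl j)"

abbreviation tcoord :: "'n::finite heis \<Rightarrow> real" where
  "tcoord x \<equiv> x $ Inr (Inr ())"

definition hmult :: "'n::finite heis \<Rightarrow> 'n heis \<Rightarrow> 'n heis" where
  "hmult x y = x + y +
     axis (Inr (Inr ())) (2 * (\<Sum>j\<in>UNIV. xcoord y j * ycoord x j - xcoord x j * ycoord y j))"

definition hom_dim :: "'n::finite itself \<Rightarrow> nat" where
  "hom_dim _ = 2 * CARD('n) + 2"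

definition hnorm :: "'n::finite heis \<Rightarrow> real" where
  "hnorm x = root 4 ((\<Sum>j\<in>UNIV. (xcoord x j)\<^sup>2 + (ycoord x j)\<^sup>2)\<^sup>2 + (tcoord x)\<^sup>2)"

text \<open>The group inverse of \<open>q\<close> is \<open>- q\<close>.\<close>

definition hdist :: "'n::finite heis \<Rightarrow> 'n heis \<Rightarrow> real" where
  "hdist p q = hnorm (hmult (- q) p)"

definition hball :: "'n::finite heis \<Rightarrow> real \<Rightarrow> 'n heis set" where
  "hball x r = {y. hdist x y < r}"

section \<open>Extended matrix norm and powers\<close>

text \<open>
  The homogeneous norm is not isotropic, so the supremum below is infinite for every matrix that
  mixes horizontal and central coordinates. It therefore takes values in $[0,\infty]$.
\<close>

definition hmat_norm :: "'n::finite hmat \<Rightarrow> ennreal" where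
  "hmat_norm M = (SUP x\<in>UNIV - {0}. ennreal (hnorm (M *v x) / hnorm x))"

text \<open>Powers on $[0,\infty]$ with the usual conventions; in particular $\infty^0 = 0^0 = 1$.\<close>

definition epowr :: "ennreal \<Rightarrow> real \<Rightarrow> ennreal" (infixr "epowr" 80) where
  "x epowr a =
     (if a = 0 then 1
      else if x = \<infinity> then (if a > 0 then \<infinity> else 0)
      else if x = 0 then (if a > 0 then 0 else \<infinity>)
      else ennreal (enn2real x powr a))"

section \<open>Weighted central Morrey spaces\<close>

definition hweight :: "real \<Rightarrow> 'n::finite heis \<Rightarrow> real" where
  "hweight \<alpha> x = hnorm x powr \<alpha>"

definition wmeasure :: "('n::finite heis \<Rightarrow> real) \<Rightarrow> 'n heis set \<Rightarrow> ennreal" where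
  "wmeasure w E = (\<integral>\<^sup>+x\<in>E. ennreal (w x) \<partial>lebesgue)"

definition locally_integrable :: "('n::finite heis \<Rightarrow> complex) \<Rightarrow> bool" where
  "locally_integrable \<Phi> \<longleftrightarrow> (\<forall>K. compact K \<longrightarrow> set_integrable lebesgue K \<Phi>)"

definition Lp_loc :: "real \<Rightarrow> ('n::finite heis \<Rightarrow> real) \<Rightarrow> ('n heis \<Rightarrow> complex) set" where
  "Lp_loc p w = {f. f \<in> borel_measurable lebesgue \<and>
     (\<forall>K. compact K \<longrightarrow> (\<integral>\<^sup>+x\<in>K. ennreal (norm (f x) powr p * w x) \<partial>lebesgue) < \<infinity>)}"

definition morrey_norm ::
    "real \<Rightarrow> real \<Rightarrow> ('n::finite heis \<Rightarrow> real) \<Rightarrow> ('n heis \<Rightarrow> complex) \<Rightarrow> ennreal" where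
  "morrey_norm p lam w f =
     (SUP r\<in>{0<..}.
        ((1 / wmeasure w (hball 0 r) epowr (1 + p * lam)) *
         (\<integral>\<^sup>+x\<in>hball 0 r. ennreal (norm (f x) powr p * w x) \<partial>lebesgue)) epowr (1 / p))"

definition central_morrey ::
    "real \<Rightarrow> real \<Rightarrow> ('n::finite heis \<Rightarrow> real) \<Rightarrow> ('n heis \<Rightarrow> complex) set" where
  "central_morrey p lam w = {f \<in> Lp_loc p w. morrey_norm p lam w f < \<infinity>}"

section \<open>The Hausdorff operator\<close>

definition hausdorff_integrand ::
    "('n::finite heis \<Rightarrow> complex) \<Rightarrow> ('n heis \<Rightarrow> 'n hmat) \<Rightarrow> ('n heis \<Rightarrow> complex) \<Rightarrow>
     'n heis \<Rightarrow> 'n heis \<Rightarrow> complex" where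
  "hausdorff_integrand \<Phi> A f x y =
     \<Phi> y / complex_of_real (hnorm y ^ hom_dim TYPE('n)) * f (A y *v x)"

text \<open>
  As usual for the Bochner integral, the value is 0 at points where the integral does not converge
  absolutely.
\<close>

definition hausdorff_op ::
    "('n::finite heis \<Rightarrow> complex) \<Rightarrow> ('n heis \<Rightarrow> 'n hmat) \<Rightarrow> ('n heis \<Rightarrow> complex) \<Rightarrow>
     'n heis \<Rightarrow> complex" where
  "hausdorff_op \<Phi> A f x = (LINT y|lebesgue. hausdorff_integrand \<Phi> A f x y)"

text \<open>
  The integrand below vanishes where \<open>\<Phi> y = 0\<close>, whatever the other factors are,
  since $0 \cdot \infty = 0$ in \<open>ennreal\<close>.
\<close>

definition C3 ::
    "real \<Rightarrow> real \<Rightarrow> ('n::finite heis \<Rightarrow> complex) \<Rightarrow> ('n heis \<Rightarrow> 'n hmat) \<Rightarrow> real \<Rightarrow> ennreal" where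
  "C3 p lam \<Phi> A \<alpha> =
     (let Q = real (hom_dim TYPE('n)) in
      if 0 < \<alpha> then
        \<integral>\<^sup>+y. ennreal (norm (\<Phi> y) / hnorm y ^ hom_dim TYPE('n)) *
              (hmat_norm (A y) epowr ((Q + \<alpha>) * (lam + 1 / p)) / ennreal (\<bar>det (A y)\<bar> powr (1 / p))) *
              hmat_norm (matrix_inv (A y)) epowr (\<alpha> / p) \<partial>lebesgue
      else
        \<integral>\<^sup>+y. ennreal (norm (\<Phi> y) / hnorm y ^ hom_dim TYPE('n)) *
              (hmat_norm (A y) epowr ((Q + \<alpha>) * (lam + 1 / p)) / ennreal (\<bar>det (A y)\<bar> powr (1 / p))) *
              hmat_norm (A y) epowr (- \<alpha> / p) \<partial>lebesgue)"

end

theory Submission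
  imports Defs
begin

text \<open>
  The inequality holds with $C = 1$. Freeze $y$ and write $M = A(y)$. The substitution $z = Mx$
  contributes the factor $|\det M|^{-1}$ and maps $B(0,r)$ into $B(0, \Vert M\Vert r)$. The weight changes by at
  most a factor $T(M)$: if $\alpha > 0$, then $|x|_h \le \Vert M^{-1}\Vert |Mx|_h$ gives
  $T(M) = \Vert M^{-1}\Vert^\alpha$; if $\alpha \le 0$, then $|Mx|_h \le \Vert M\Vert |x|_h$ gives
  $T(M) = \Vert M\Vert^{-\alpha}$. Since $w(B(0,\rho r)) = \rho^{Q+\alpha} w(B(0,r))$, the definition
  of the Morrey norm on the ball of radius $\Vert M\Vert r$ bounds the weighted $L^p$ norm of
  $f \circ M$ on $B(0,r)$ by
  $w(B(0,r))^{\lambda+1/p} \Vert f\Vert$ times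
  $\Vert M\Vert^{(Q+\alpha)(\lambda+1/p)} |\det M|^{-1/p} T(M)^{1/p}$
  (lemma \<open>morrey_ball_norm_compose_le\<close>). Multiplied by $|\Phi(y)| / |y|_h^Q$, the last factor is the
  integrand of $C_3(\alpha)$, so Minkowski's integral inequality in $L^p(B(0,r); w)$ yields the bound
  for the majorant $x \mapsto \int |\Phi(y)| |y|_h^{-Q} |f(A(y)x)|\,dy$ of the Hausdorff operator
  (lemma \<open>hausdorff_majorant_ball_bound\<close>). Its finiteness gives absolute convergence almost
  everywhere when $C_3(\alpha) < \infty$.

  Four points need more care. A Lebesgue measurable $f$ composed with $(x,y) \mapsto A(y)x$ need not be
  measurable on the product, so $f$ is first replaced by a Borel function; this changes the integrand
  only on a null set, because an invertible matrix pulls null sets back to null sets. The norm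
  $\Vert A(y)\Vert$ may be infinite, and then the bound comes from monotone convergence over all
  balls. The finiteness of $w(B(0,1))$ for $-Q < \alpha$ follows from a dyadic decomposition.
  Finally, the linear change of variables is proved by factoring $M$ into elementary matrices, which
  works for coordinates indexed by any finite type, such as the sum type used for the Heisenberg group.
\<close>

section \<open>Linear change of variables\<close>

text \<open>
  A linear bijection that scales the measure of every box by \<open>d\<close> scales the measure of every
  measurable set by \<open>d\<close>. Hence \<open>d\<close> times the image of Lebesgue measure under \<open>f\<close> gives every box its
  volume, and Lebesgue measure is the only Borel measure with this property.
\<close>

lemma nn_integral_linear_of_measure_image_cbox:
  fixes f :: "'a::euclidean_space \<Rightarrow> 'a"
  assumes f: "linear f" "bij f" and d: "d > 0"
    and im: "\<And>a b. measure lebesgue (f ` cbox a b) = d * measure lebesgue (cbox a b)"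
    and h[measurable]: "h \<in> borel_measurable borel"
  shows "(\<integral>\<^sup>+x. h x \<partial>lborel) = ennreal d * (\<integral>\<^sup>+x. h (f x) \<partial>lborel)"
proof -
  have [measurable]: "f \<in> borel_measurable borel"
    using f(1) by (intro borel_measurable_continuous_onI linear_continuous_on linear_conv_bounded_linear[THEN iffD1])
  have "lborel = scale_measure (ennreal d) (distr lborel borel f)"
  proof (rule lborel_eqI)
    fix l u :: 'a assume le: "\<And>b. b \<in> Basis \<Longrightarrow> l \<bullet> b \<le> u \<bullet> b"
    obtain g where g: "linear g" "g \<circ> f = id"
      using f by (metis linear_injective_left_inverse bij_is_inj)
    have fg: "f (g x) = x" for x
      using f(2) g(2) by (metis bij_pointE comp_apply id_apply)
    have gf: "g (f x) = x" for x
      using g(2) by (metis comp_apply id_apply)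
    have "f -` box l u = g ` box l u"
      by (auto simp: fg) (metis gf imageI)
    then have "bounded (f -` box l u)"
      using g(1) by (simp add: bounded_linear_image bounded_box linear_conv_bounded_linear)
    moreover have B: "f -` box l u \<in> sets lborel"
      using measurable_sets_borel[of f borel "box l u"] by simp
    ultimately have S: "f -` box l u \<in> lmeasurable"
      by (blast intro: bounded_set_imp_lmeasurable sets_completionI_sets)
    have "d * measure lebesgue (f -` box l u) = measure lebesgue (f ` (f -` box l u))"
      using measure_linear_sufficient[OF f(1) S im] by blast
    also have "f ` (f -` box l u) = box l u"
      using f(2) by (simp add: bij_is_surj surj_image_vimage_eq)
    also have "measure lebesgue (box l u) = (\<Prod>b\<in>Basis. (u - l) \<bullet> b)"
      using le by (simp add: measure_lborel_box_eq)
    finally have "ennreal (d * measure lebesgue (f -` box l u)) = ennreal (\<Prod>b\<in>Basis. (u - l) \<bullet> b)"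
      by simp
    then have "ennreal d * ennreal (measure lebesgue (f -` box l u)) = ennreal (\<Prod>b\<in>Basis. (u - l) \<bullet> b)"
      using d by (subst (asm) ennreal_mult) auto
    moreover have "emeasure lborel (f -` box l u) = ennreal (measure lebesgue (f -` box l u))"
      using S B by (simp add: emeasure_eq_measure2[symmetric] fmeasurable_def)
    ultimately show "emeasure (scale_measure (ennreal d) (distr lborel borel f)) (box l u)
        = ennreal (\<Prod>b\<in>Basis. (u - l) \<bullet> b)"
      by (simp add: emeasure_distr)
  qed simp
  then have "(\<integral>\<^sup>+x. h x \<partial>lborel) = (\<integral>\<^sup>+x. h x \<partial>scale_measure (ennreal d) (distr lborel borel f))"
    by simp
  also have "\<dots> = ennreal d * (\<integral>\<^sup>+x. h (f x) \<partial>lborel)"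
    by (simp add: nn_integral_scale_measure nn_integral_distr)
  finally show ?thesis .
qed

text \<open>
  The shear of a box has a known measure when the \<open>n\<close>-th side starts in the nonnegative reals.
  A translation moves any box there, and a linear map carries translates to translates.
\<close>

lemma measure_shear_cbox:
  fixes a b :: "real^'n"
  assumes mn: "m \<noteq> n"
  defines "S \<equiv> \<lambda>x::real^'n. \<chi> i. if i = m then x $ m + x $ n else x $ i"
  shows "measure lebesgue (S ` cbox a b) = measure lebesgue (cbox a b)"
proof (cases "cbox a b = {}")
  case False
  define v :: "real^'n" where "v = axis n (- a $ n)"
  have lin: "linear S"
    unfolding S_def by (rule linearI) (auto simp: algebra_simps vec_eq_iff)
  have "measure lebesgue (S ` cbox (v + a) (v + b)) = measure lebesgue (cbox (v + a) (v + b))"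
    unfolding S_def using False mn
    by (intro measure_shear_interval) (auto simp: cbox_translation v_def)
  moreover have "S ` cbox (v + a) (v + b) = (+) (S v) ` S ` cbox a b"
    unfolding cbox_translation image_image by (simp add: linear_add[OF lin])
  ultimately show ?thesis
    by (simp add: cbox_translation measure_translation)
qed simp

text \<open>
  Every square matrix is a product of diagonal matrices, coordinate transpositions, unit shears and
  matrices with a zero row. The formula is multiplicative in \<open>M\<close>, and a matrix with a zero row has
  determinant 0, so it is enough to know what the three remaining kinds do to boxes.
\<close>

theorem nn_integral_matrix_vector_mult:
  fixes M :: "real^'n^'n"
  assumes "det M \<noteq> 0" and "h \<in> borel_measurable borel"
  shows "(\<integral>\<^sup>+x. h x \<partial>lborel) = ennreal \<bar>det M\<bar> * (\<integral>\<^sup>+x. h (M *v x) \<partial>lborel)"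
proof -
  have "det M \<noteq> 0 \<longrightarrow> (\<forall>h\<in>borel_measurable borel.
          (\<integral>\<^sup>+x. h x \<partial>lborel) = ennreal \<bar>det M\<bar> * (\<integral>\<^sup>+x. h (M *v x) \<partial>lborel))" (is "?P M")
  proof (induction M rule: induct_matrix_elementary_alt)
    case (1 A B)
    show ?case
    proof (intro impI ballI)
      fix h :: "real^'n \<Rightarrow> ennreal" assume h[measurable]: "h \<in> borel_measurable borel" and "det (A ** B) \<noteq> 0"
      then have nz: "det A \<noteq> 0" "det B \<noteq> 0"
        by (auto simp: det_mul)
      have m[measurable]: "(\<lambda>x. A *v x) \<in> borel_measurable borel"
        by (intro borel_measurable_continuous_onI matrix_vector_mult_linear_continuous_on)
      have "(\<integral>\<^sup>+x. h x \<partial>lborel) = ennreal \<bar>det A\<bar> * (\<integral>\<^sup>+x. h (A *v x) \<partial>lborel)"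
        using 1(1) nz h by blast
      also have "(\<integral>\<^sup>+x. h (A *v x) \<partial>lborel) = ennreal \<bar>det B\<bar> * (\<integral>\<^sup>+x. h (A *v (B *v x)) \<partial>lborel)"
        using 1(2) nz by simp
      finally show "(\<integral>\<^sup>+x. h x \<partial>lborel) = ennreal \<bar>det (A ** B)\<bar> * (\<integral>\<^sup>+x. h ((A ** B) *v x) \<partial>lborel)"
        by (simp add: det_mul abs_mult ennreal_mult matrix_vector_mul_assoc mult.assoc)
    qed
  next
    case (2 A i)
    then show ?case
      by (simp add: det_zero_row)
  next
    case (3 A)
    have M: "(*v) A = (\<lambda>x. \<chi> i. A $ i $ i * x $ i)"
    proof (intro ext, unfold vec_eq_iff, intro allI)
      fix x i
      have "(A *v x) $ i = (\<Sum>j\<in>UNIV. A $ i $ j * x $ j)"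
        by (simp add: matrix_vector_mult_def)
      also have "\<dots> = (\<Sum>j\<in>UNIV. if j = i then A $ i $ i * x $ i else 0)"
        using 3 by (intro sum.cong) auto
      finally have "(A *v x) $ i = \<dots>" .
      then show "(A *v x) $ i = (\<chi> i. A $ i $ i * x $ i) $ i"
        by simp
    qed
    show ?case
    proof (intro impI ballI)
      fix h :: "real^'n \<Rightarrow> ennreal" assume h: "h \<in> borel_measurable borel" and nz: "det A \<noteq> 0"
      show "(\<integral>\<^sup>+x. h x \<partial>lborel) = ennreal \<bar>det A\<bar> * (\<integral>\<^sup>+x. h (A *v x) \<partial>lborel)"
      proof (rule nn_integral_linear_of_measure_image_cbox[OF _ _ _ _ h])
        show "bij ((*v) A)"
          using nz by (simp add: invertible_det_nz[symmetric] invertible_eq_bij)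
        show "measure lebesgue ((*v) A ` cbox a b) = \<bar>det A\<bar> * measure lebesgue (cbox a b)" for a b
          unfolding M using 3 by (subst measure_stretch) (auto simp: det_diagonal)
      qed (use nz in auto)
    qed
  next
    case (4 m n)
    let ?A = "(\<chi> i j. mat 1 $ i $ Transposition.transpose m n j) :: real^'n^'n"
    have det: "\<bar>det ?A\<bar> = 1"
      by (simp add: det_permute_columns permutes_swap_id sign_swap_id abs_mult)
    have M: "(*v) ?A = (\<lambda>x. \<chi> i. x $ Transposition.transpose m n i)"
    proof (intro ext, unfold vec_eq_iff, intro allI)
      fix x i
      have "(?A *v x) $ i = (\<Sum>j\<in>UNIV. mat 1 $ i $ Transposition.transpose m n j * x $ j)"
        by (simp add: matrix_vector_mult_def)
      also have "\<dots> = (\<Sum>j\<in>UNIV. if j = Transposition.transpose m n i then x $ j else 0)"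
        by (intro sum.cong) (auto simp: mat_def)
      finally have "(?A *v x) $ i = \<dots>" .
      then show "(?A *v x) $ i = (\<chi> i. x $ Transposition.transpose m n i) $ i"
        by simp
    qed
    show ?case
    proof (intro impI ballI)
      fix h :: "real^'n \<Rightarrow> ennreal" assume h: "h \<in> borel_measurable borel"
      show "(\<integral>\<^sup>+x. h x \<partial>lborel) = ennreal \<bar>det ?A\<bar> * (\<integral>\<^sup>+x. h (?A *v x) \<partial>lborel)"
      proof (rule nn_integral_linear_of_measure_image_cbox[OF _ _ _ _ h])
        show "bij ((*v) ?A)"
          using det by (auto simp: invertible_eq_bij[symmetric] invertible_det_nz)
        show "measure lebesgue ((*v) ?A ` cbox a b) = \<bar>det ?A\<bar> * measure lebesgue (cbox a b)" for a b
        proof -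
          let ?p = "\<lambda>x::real^'n. \<chi> i. x $ Transposition.transpose m n i"
          have "?p ` cbox a b = cbox (?p a) (?p b)"
          proof (intro set_eqI iffI)
            fix y assume "y \<in> cbox (?p a) (?p b)"
            then have "?p y \<in> cbox a b"
              by (simp add: mem_box_cart) (metis transpose_involutory)
            moreover have "y = ?p (?p y)"
              by (simp add: vec_eq_iff)
            ultimately show "y \<in> ?p ` cbox a b"
              by blast
          qed (auto simp: mem_box_cart)
          moreover have "(\<Prod>i\<in>UNIV. b $ Transposition.transpose m n i - a $ Transposition.transpose m n i)
              = (\<Prod>i\<in>UNIV. b $ i - a $ i)"
            using prod.permute[OF permutes_swap_id, of m UNIV n "\<lambda>i. b $ i - a $ i"] by (simp add: o_def)
          moreover have "cbox (?p a) (?p b) = {} \<longleftrightarrow> cbox a b = {}"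
            by (simp add: interval_eq_empty_cart) (metis transpose_involutory)
          ultimately show ?thesis
            unfolding M det by (simp add: content_cbox_if_cart)
        qed
      qed (use det in auto)
    qed
  next
    case (5 m n)
    let ?A = "(\<chi> i j. of_bool (i = m \<and> j = n \<or> i = j)) :: real^'n^'n"
    have "?A = (\<chi> k. if k = m then row m (mat 1) + 1 *s row n (mat 1) else row k (mat 1))"
      using 5 by (auto simp: vec_eq_iff row_def mat_def)
    then have det: "det ?A = 1"
      by (simp only: det_row_operation[OF 5] det_I)
    have M: "(*v) ?A = (\<lambda>x. \<chi> i. if i = m then x $ m + x $ n else x $ i)"
    proof (intro ext, unfold vec_eq_iff, intro allI)
      fix x i
      have "(?A *v x) $ i = (\<Sum>j\<in>UNIV. of_bool (i = m \<and> j = n \<or> i = j) * x $ j)"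
        by (simp add: matrix_vector_mult_def)
      also have "\<dots> = (\<Sum>j\<in>UNIV. (if j = i then x $ j else 0) + (if j = n then if i = m then x $ j else 0 else 0))"
        using 5 by (intro sum.cong) auto
      finally have "(?A *v x) $ i = \<dots>" .
      then show "(?A *v x) $ i = (\<chi> i. if i = m then x $ m + x $ n else x $ i) $ i"
        by (simp add: sum.distrib)
    qed
    show ?case
    proof (intro impI ballI)
      fix h :: "real^'n \<Rightarrow> ennreal" assume h: "h \<in> borel_measurable borel"
      show "(\<integral>\<^sup>+x. h x \<partial>lborel) = ennreal \<bar>det ?A\<bar> * (\<integral>\<^sup>+x. h (?A *v x) \<partial>lborel)"
      proof (rule nn_integral_linear_of_measure_image_cbox[OF _ _ _ _ h])
        show "bij ((*v) ?A)"
          using det by (auto simp: invertible_eq_bij[symmetric] invertible_det_nz)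
        show "measure lebesgue ((*v) ?A ` cbox a b) = \<bar>det ?A\<bar> * measure lebesgue (cbox a b)" for a b
          using measure_shear_cbox[OF 5, of a b] unfolding M det by simp
      qed (use det in auto)
    qed
  qed
  with assms show ?thesis
    by blast
qed

section \<open>Powers of extended nonnegative reals\<close>

lemma epowr_0_right [simp]: "x epowr 0 = 1"
  by (simp add: epowr_def)

lemma epowr_1_right [simp]: "x epowr 1 = x"
  by (cases x) (auto simp: epowr_def)

lemma zero_epowr: "a > 0 \<Longrightarrow> 0 epowr a = 0"
  by (simp add: epowr_def)

lemma top_epowr: "a > 0 \<Longrightarrow> top epowr a = top"
  by (simp add: epowr_def)

lemma ennreal_epowr_pos: "x > 0 \<Longrightarrow> ennreal x epowr a = ennreal (x powr a)"
  by (simp add: epowr_def)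

lemma ennreal_epowr: "x \<ge> 0 \<Longrightarrow> a > 0 \<Longrightarrow> ennreal x epowr a = ennreal (x powr a)"
  by (cases "x = 0") (simp_all add: zero_epowr ennreal_epowr_pos)

lemma epowr_mult:
  assumes "a \<ge> 0"
  shows "(x * y) epowr a = x epowr a * y epowr a"
proof (cases "a = 0")
  case False
  with assms have a: "a > 0" by simp
  consider "x = 0" | "y = 0" | "x = top" "y \<noteq> 0" | "y = top" "x \<noteq> 0"
    | r s where "r > 0" "s > 0" "x = ennreal r" "y = ennreal s"
    by (cases x; cases y) (auto simp: ennreal_eq_0_iff not_le less_eq_real_def)
  then show ?thesis
  proof cases
    case 3
    have "y epowr a \<noteq> 0"
      using 3 a by (auto simp: epowr_def ennreal_eq_0_iff enn2real_eq_0_iff)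
    then show ?thesis
      using 3 a by (simp add: top_epowr ennreal_top_mult)
  next
    case 4
    have "x epowr a \<noteq> 0"
      using 4 a by (auto simp: epowr_def ennreal_eq_0_iff enn2real_eq_0_iff)
    then show ?thesis
      using 4 a by (simp add: top_epowr ennreal_mult_top)
  next
    case 5
    then show ?thesis
      by (simp add: ennreal_epowr_pos ennreal_mult[symmetric] powr_mult)
  qed (use a in \<open>simp_all add: zero_epowr\<close>)
qed simp

lemma epowr_epowr:
  assumes "a \<ge> 0" "b \<ge> 0"
  shows "(x epowr a) epowr b = x epowr (a * b)"
proof -
  consider "a = 0 \<or> b = 0" | "x = 0" "a > 0" "b > 0" | "x = top" "a > 0" "b > 0" | r where "x = ennreal r" "r > 0"
    using assms by (cases x) (auto simp: less_eq_real_def)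
  then show ?thesis
  proof cases
    case 1
    then show ?thesis
      by (auto simp: epowr_def)
  qed (simp_all add: zero_epowr top_epowr ennreal_epowr_pos powr_powr)
qed

lemma epowr_mono: "a \<ge> 0 \<Longrightarrow> x \<le> y \<Longrightarrow> x epowr a \<le> y epowr a"
  by (cases "a = 0"; cases x; cases y)
     (auto simp: top_epowr ennreal_epowr powr_mono2 ennreal_leI top_unique)

lemma epowr_eq_top_iff: "a > 0 \<Longrightarrow> x epowr a = top \<longleftrightarrow> x = top"
  by (cases x) (auto simp: top_epowr ennreal_epowr)

lemma epowr_eq_0_iff: "a > 0 \<Longrightarrow> x epowr a = 0 \<longleftrightarrow> x = 0"
  by (cases x) (auto simp: top_epowr ennreal_epowr ennreal_eq_0_iff zero_epowr)

lemma epowr_inverse_exponent: "p > 0 \<Longrightarrow> (x epowr p) epowr (1 / p) = x"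
  "p > 0 \<Longrightarrow> (x epowr (1 / p)) epowr p = x"
  by (simp_all add: epowr_epowr)

lemma borel_measurable_epowr [measurable (raw)]:
  assumes [measurable]: "f \<in> borel_measurable M"
  shows "(\<lambda>x. f x epowr a) \<in> borel_measurable M"
  unfolding epowr_def by measurable

text \<open>
  The right-hand side minus the left-hand side measures how far the convex function $t^p$ lies above
  its tangent at \<open>s\<close>. The tangent is written without subtraction so that it makes sense for
  $t = \infty$.
\<close>

lemma epowr_tangent:
  fixes t :: ennreal and s p :: real
  assumes p: "p \<ge> 1" and s: "s > 0"
  shows "ennreal (p * s powr (p - 1)) * t \<le> t epowr p + ennreal ((p - 1) * s powr p)"
proof (cases t)
  case (real r)
  have "p * s powr (p - 1) * r \<le> r powr p + (p - 1) * s powr p"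
  proof (cases "p = 1 \<or> r = 0")
    case True
    then show ?thesis
      using real s p by auto
  next
    case False
    with p have p1: "p > 1" by auto
    have "r * s powr (p - 1) \<le> r powr p / p + (s powr (p - 1)) powr (p / (p - 1)) / (p / (p - 1))"
      using p1 real s by (intro Youngs_inequality) (auto simp: field_simps)
    also have "(s powr (p - 1)) powr (p / (p - 1)) = s powr p"
      using p1 by (simp add: powr_powr)
    finally show ?thesis
      using p1 by (simp add: field_simps)
  qed
  then show ?thesis
    using real p s by (simp add: ennreal_epowr ennreal_mult[symmetric] ennreal_plus[symmetric] del: ennreal_plus)
next
  case top
  then show ?thesis
    using p by (simp add: top_epowr)
qed

text \<open>
  Jensen's inequality for the measure with density \<open>k\<close> and total mass \<open>K\<close>: integrate the tangent of
  $t^p$ at the mean value \<open>s = (\<integral>\<^sup>+y. G y * k y \<partial>N) / K\<close>.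
\<close>

lemma nn_integral_Jensen_epowr:
  assumes p: "p \<ge> 1" and G[measurable]: "G \<in> borel_measurable N" and k[measurable]: "k \<in> borel_measurable N"
    and K: "(\<integral>\<^sup>+y. k y \<partial>N) = ennreal K" "K > 0"
  shows "(\<integral>\<^sup>+y. G y * k y \<partial>N) epowr p \<le> ennreal (K powr (p - 1)) * (\<integral>\<^sup>+y. G y epowr p * k y \<partial>N)"
proof -
  let ?I = "\<integral>\<^sup>+y. G y * k y \<partial>N" and ?J = "\<integral>\<^sup>+y. G y epowr p * k y \<partial>N"
  have tangent: "ennreal (p * s powr (p - 1)) * ?I \<le> ?J + ennreal ((p - 1) * s powr p * K)" if s: "s > 0" for s
  proof -
    have "ennreal (p * s powr (p - 1)) * ?I = (\<integral>\<^sup>+y. ennreal (p * s powr (p - 1)) * G y * k y \<partial>N)"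
      by (simp add: nn_integral_cmult mult.assoc)
    also have "\<dots> \<le> (\<integral>\<^sup>+y. (G y epowr p + ennreal ((p - 1) * s powr p)) * k y \<partial>N)"
      by (intro nn_integral_mono mult_right_mono epowr_tangent p s) auto
    also have "\<dots> = ?J + ennreal ((p - 1) * s powr p) * (\<integral>\<^sup>+y. k y \<partial>N)"
      by (simp add: distrib_right nn_integral_add nn_integral_cmult)
    also have "\<dots> = ?J + ennreal ((p - 1) * s powr p * K)"
      using p K by (simp add: ennreal_mult)
    finally show ?thesis .
  qed
  show ?thesis
  proof (cases "?I = top")
    case True
    have "?J = top"
      \<comment> \<open>any tangent with positive slope forces the right-hand side to be infinite\<close>
      using tangent[of 1] p by (auto simp: True ennreal_mult_top top_unique)
    then show ?thesis
      using K by (simp add: ennreal_mult_top)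
  next
    case False
    then obtain i where i: "?I = ennreal i" "i \<ge> 0"
      by (cases ?I) auto
    show ?thesis
    proof (cases "?J = top \<or> i = 0")
      case True
      then show ?thesis
        using K i p by (auto simp: ennreal_mult_top zero_epowr)
    next
      case False
      then obtain j where j: "?J = ennreal j" "j \<ge> 0"
        by (cases ?J) auto
      \<comment> \<open>the mean value of \<open>G\<close>, where the tangent is best\<close>
      define s where "s = i / K"
      have s: "s > 0"
        using False i K by (simp add: s_def)
      have "p * s powr (p - 1) * i \<le> j + (p - 1) * s powr p * K"
        using tangent[OF s] p i j s K
        by (simp add: ennreal_mult[symmetric] ennreal_plus[symmetric] del: ennreal_plus)
      moreover have sp: "s powr p = s powr (p - 1) * s"
        using s by (simp add: powr_diff)
      moreover have sK: "s * K = i"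
        using K by (simp add: s_def)
      moreover have "(p - 1) * s powr p * K = (p - 1) * (s powr (p - 1) * i)"
        unfolding sp sK[symmetric] by (simp only: mult.assoc)
      ultimately have "s powr (p - 1) * i \<le> j"
        by (simp add: left_diff_distrib mult.assoc)
      then have "K powr (p - 1) * (s powr (p - 1) * i) \<le> K powr (p - 1) * j"
        by (intro mult_left_mono) auto
      moreover have "K powr (p - 1) * (s powr (p - 1) * i) = i powr p"
        using s K i by (simp add: s_def powr_divide powr_diff)
      ultimately show ?thesis
        using i j p by (simp add: ennreal_epowr ennreal_mult[symmetric])
    qed
  qed
qed

text \<open>
  With \<open>k y\<close> the $L^p$ norm of \<open>\<lambda>x. F x y\<close>, write the inner integral as $\int (F/k)\, k\,dy$ and
  apply Jensen's inequality with density \<open>k\<close>. After exchanging the integrals, every section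
  of $F/k$ has $L^p$ norm at most 1, so only the total mass of \<open>k\<close> remains. Where \<open>k y = 0\<close>, the section
  vanishes almost everywhere and $0/0 = 0$ does no harm.
\<close>

lemma Minkowski_nn_integral:
  assumes p: "p \<ge> 1" and sf: "sigma_finite_measure M" "sigma_finite_measure N"
    and F[measurable]: "(\<lambda>(x, y). F x y) \<in> borel_measurable (M \<Otimes>\<^sub>M N)"
  shows "(\<integral>\<^sup>+x. (\<integral>\<^sup>+y. F x y \<partial>N) epowr p \<partial>M) epowr (1 / p)
    \<le> (\<integral>\<^sup>+y. (\<integral>\<^sup>+x. F x y epowr p \<partial>M) epowr (1 / p) \<partial>N)"
proof -
  interpret M: sigma_finite_measure M by fact
  interpret N: sigma_finite_measure N by fact
  interpret MN: pair_sigma_finite M N ..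
  define k where "k y = (\<integral>\<^sup>+x. F x y epowr p \<partial>M) epowr (1 / p)" for y
  have F'[measurable]: "(\<lambda>(y, x). F x y) \<in> borel_measurable (N \<Otimes>\<^sub>M M)"
    using measurable_pair_swap[OF F] by (simp add: case_prod_beta')
  have k[measurable]: "k \<in> borel_measurable N"
    unfolding k_def by measurable
  have kp: "k y epowr p = (\<integral>\<^sup>+x. F x y epowr p \<partial>M)" for y
    using p by (simp add: k_def epowr_inverse_exponent)
  have k0: "AE x in M. AE y in N. k y = 0 \<longrightarrow> F x y = 0"
  proof (subst MN.AE_commute)
    have "AE x in M. F x y = 0" if "y \<in> space N" "k y = 0" for y
    proof -
      have "(\<integral>\<^sup>+x. F x y epowr p \<partial>M) = 0"
        using kp[of y] that p by (simp add: zero_epowr)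
      then have "AE x in M. F x y epowr p = 0"
        using that(1) by (subst (asm) nn_integral_0_iff_AE) measurable
      then show ?thesis
        using p by (simp add: epowr_eq_0_iff)
    qed
    then have "AE x in M. k y = 0 \<longrightarrow> F x y = 0" if "y \<in> space N" for y
      using that by (cases "k y = 0") simp_all
    then show "AE y in N. AE x in M. k y = 0 \<longrightarrow> F x y = 0"
      by (rule AE_I2)
  qed measurable
  show ?thesis
  proof (cases "(\<integral>\<^sup>+y. k y \<partial>N) = top \<or> (\<integral>\<^sup>+y. k y \<partial>N) = 0")
    case True
    then consider "(\<integral>\<^sup>+y. k y \<partial>N) = top" | "AE y in N. k y = 0"
      by (auto simp: nn_integral_0_iff_AE)
    then show ?thesis
    proof cases
      case 1
      then show ?thesis
        by (simp add: k_def)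
    next
      case 2
      have "AE x in M. (\<integral>\<^sup>+y. F x y \<partial>N) epowr p = 0"
        using k0
      proof eventually_elim
        case (elim x)
        then have "AE y in N. F x y = 0"
          using 2 by eventually_elim auto
        then have "(\<integral>\<^sup>+y. F x y \<partial>N) = (\<integral>\<^sup>+y. 0 \<partial>N)"
          by (rule nn_integral_cong_AE)
        then show ?case
          using p by (simp add: zero_epowr)
      qed
      then have "(\<integral>\<^sup>+x. (\<integral>\<^sup>+y. F x y \<partial>N) epowr p \<partial>M) = (\<integral>\<^sup>+x. 0 \<partial>M)"
        by (rule nn_integral_cong_AE)
      then show ?thesis
        using p by (simp add: zero_epowr)
    qed
  next
    case False
    then obtain K where K: "(\<integral>\<^sup>+y. k y \<partial>N) = ennreal K" "K > 0"
      by (cases "\<integral>\<^sup>+y. k y \<partial>N") (auto simp: less_eq_real_def)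
    have ktop: "AE y in N. k y \<noteq> top"
      using nn_integral_noteq_infinite[of k N] K by simp
    have pos: "p > 0" using p by simp
    have Gk: "F x y / k y * k y = F x y" if "k y = 0 \<longrightarrow> F x y = 0" "k y \<noteq> top" for x y
      using that by (cases "k y = 0") (auto simp: ennreal_divide_times ennreal_divide_self less_top)
    have Gkp: "(\<integral>\<^sup>+x. (F x y / k y) epowr p * k y \<partial>M) \<le> k y" if "k y \<noteq> top" "y \<in> space N" for y
    proof (cases "k y = 0")
      case False
      have "(\<integral>\<^sup>+x. (F x y / k y) epowr p * k y \<partial>M) = (\<integral>\<^sup>+x. F x y epowr p * (inverse (k y) epowr p * k y) \<partial>M)"
        using p by (simp add: divide_ennreal_def epowr_mult mult.assoc)
      also have "\<dots> = k y epowr p * (inverse (k y) epowr p * k y)"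
        unfolding kp using that(2) by (intro nn_integral_multc) measurable
      also have "\<dots> = (k y * inverse (k y)) epowr p * k y"
        using p by (simp add: epowr_mult mult.assoc)
      also have "k y * inverse (k y) = 1"
        using False that by (simp add: divide_ennreal_def[symmetric] ennreal_divide_self less_top)
      finally show ?thesis
        using p ennreal_epowr_pos[of 1 p] by simp
    qed simp
    have "(\<integral>\<^sup>+x. (\<integral>\<^sup>+y. F x y \<partial>N) epowr p \<partial>M)
        \<le> (\<integral>\<^sup>+x. ennreal (K powr (p - 1)) * (\<integral>\<^sup>+y. (F x y / k y) epowr p * k y \<partial>N) \<partial>M)"
    proof (rule nn_integral_mono_AE)
      show "AE x in M. (\<integral>\<^sup>+y. F x y \<partial>N) epowr p
          \<le> ennreal (K powr (p - 1)) * (\<integral>\<^sup>+y. (F x y / k y) epowr p * k y \<partial>N)"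
        using k0 AE_space
      proof eventually_elim
        case (elim x)
        have "(\<integral>\<^sup>+y. F x y \<partial>N) = (\<integral>\<^sup>+y. F x y / k y * k y \<partial>N)"
          using elim(1) ktop by (intro nn_integral_cong_AE, eventually_elim) (simp add: Gk)
        moreover have "(\<lambda>y. F x y / k y) \<in> borel_measurable N"
          using elim(2) by measurable
        ultimately show ?case
          using nn_integral_Jensen_epowr[OF p _ k K, of "\<lambda>y. F x y / k y"] by simp
      qed
    qed
    also have "\<dots> = ennreal (K powr (p - 1)) * (\<integral>\<^sup>+x. (\<integral>\<^sup>+y. (F x y / k y) epowr p * k y \<partial>N) \<partial>M)"
      by (rule nn_integral_cmult) measurable
    also have "(\<integral>\<^sup>+x. (\<integral>\<^sup>+y. (F x y / k y) epowr p * k y \<partial>N) \<partial>M)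
        = (\<integral>\<^sup>+y. (\<integral>\<^sup>+x. (F x y / k y) epowr p * k y \<partial>M) \<partial>N)"
      by (rule MN.Fubini'[symmetric]) measurable
    also have "\<dots> \<le> (\<integral>\<^sup>+y. k y \<partial>N)"
      using ktop AE_space by (intro nn_integral_mono_AE, eventually_elim) (rule Gkp)
    also have "ennreal (K powr (p - 1)) * (\<integral>\<^sup>+y. k y \<partial>N) = ennreal (K powr p)"
      using K by (simp add: ennreal_mult[symmetric] powr_diff)
    also have "\<dots> = (\<integral>\<^sup>+y. k y \<partial>N) epowr p"
      using K by (simp add: ennreal_epowr_pos)
    finally have "(\<integral>\<^sup>+x. (\<integral>\<^sup>+y. F x y \<partial>N) epowr p \<partial>M) \<le> (\<integral>\<^sup>+y. k y \<partial>N) epowr p"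
      by (simp add: mult_left_mono)
    then have "(\<integral>\<^sup>+x. (\<integral>\<^sup>+y. F x y \<partial>N) epowr p \<partial>M) epowr (1 / p) \<le> ((\<integral>\<^sup>+y. k y \<partial>N) epowr p) epowr (1 / p)"
      using p by (intro epowr_mono) auto
    then show ?thesis
      using pos by (simp add: epowr_inverse_exponent k_def)
  qed
qed

text \<open>
  The integral of an arbitrary function is the supremum of the integrals of the simple functions below
  it, and dividing by \<open>c\<close> turns a simple function below \<open>c * k\<close> into one below \<open>k\<close>. In the
  application \<open>k\<close> contains the norm of \<open>A y\<close>, a supremum over uncountably many vectors.
\<close>

lemma nn_integral_cmult_le:
  fixes c :: ennreal
  assumes c: "c < top"
  shows "(\<integral>\<^sup>+x. c * k x \<partial>M) \<le> c * (\<integral>\<^sup>+x. k x \<partial>M)"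
proof (cases "c = 0")
  case False
  show ?thesis
    unfolding nn_integral_def[of M "\<lambda>x. c * k x"]
  proof (rule SUP_least, clarify)
    fix s assume s: "simple_function M s" "s \<le> (\<lambda>x. c * k x)"
    have m[measurable]: "s \<in> borel_measurable M"
      using s(1) by (rule borel_measurable_simple_function)
    have le: "s x / c \<le> k x" for x
      using s(2) False c by (auto simp: le_fun_def divide_le_posI_ennreal zero_less_iff_neq_zero mult.commute)
    have "integral\<^sup>S M s = (\<integral>\<^sup>+x. s x \<partial>M)"
      using s(1) by (simp add: nn_integral_eq_simple_integral)
    also have "\<dots> = (\<integral>\<^sup>+x. c * (s x / c) \<partial>M)"
      using False c by (intro nn_integral_cong) (metis ennreal_mult_divide_eq ennreal_times_divide less_top mult.commute)
    also have "\<dots> = c * (\<integral>\<^sup>+x. s x / c \<partial>M)"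
      by (rule nn_integral_cmult) measurable
    also have "\<dots> \<le> c * (\<integral>\<^sup>+x. k x \<partial>M)"
      by (intro mult_left_mono nn_integral_mono le) auto
    finally show "integral\<^sup>S M s \<le> c * (\<integral>\<^sup>+x. k x \<partial>M)" .
  qed
qed simp

section \<open>Homogeneous norm, balls and power weights\<close>

lemma hnorm_nonneg [simp]: "hnorm x \<ge> 0"
  by (simp add: hnorm_def)

lemma hnorm_pow4: "hnorm x ^ 4 = (\<Sum>j\<in>UNIV. (xcoord x j)\<^sup>2 + (ycoord x j)\<^sup>2)\<^sup>2 + (tcoord x)\<^sup>2"
  by (simp add: hnorm_def)

lemma hnorm_eq_0_iff [simp]: "hnorm x = 0 \<longleftrightarrow> x = 0"
proof
  assume "hnorm x = 0"
  then have "(\<Sum>j\<in>UNIV. (xcoord x j)\<^sup>2 + (ycoord x j)\<^sup>2)\<^sup>2 + (tcoord x)\<^sup>2 = 0"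
    using hnorm_pow4[of x] by simp
  then have "(\<Sum>j\<in>UNIV. (xcoord x j)\<^sup>2 + (ycoord x j)\<^sup>2) = 0" "tcoord x = 0"
    by (simp_all add: add_nonneg_eq_0_iff)
  then have "xcoord x j = 0" "ycoord x j = 0" for j
    by (simp_all add: sum_nonneg_eq_0_iff add_nonneg_eq_0_iff)
  with \<open>tcoord x = 0\<close> have "x $ i = 0" for i
    by (cases i rule: sum.exhaust[OF _ sum.exhaust]) (auto, metis old.sum.exhaust old.unit.exhaust)
  then show "x = 0"
    by (simp add: vec_eq_iff)
next
  assume "x = 0"
  then show "hnorm x = 0"
    by (simp add: hnorm_def)
qed

lemma hnorm_0 [simp]: "hnorm 0 = 0"
  by (simp only: hnorm_eq_0_iff)

lemma hnorm_pos_iff [simp]: "hnorm x > 0 \<longleftrightarrow> x \<noteq> 0"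
  using hnorm_nonneg[of x] hnorm_eq_0_iff[of x] by linarith

lemma continuous_on_hnorm [continuous_intros]: "continuous_on S hnorm"
  unfolding hnorm_def[abs_def] by (intro continuous_intros)

lemma borel_measurable_hnorm [measurable]: "hnorm \<in> borel_measurable borel"
  by (intro borel_measurable_continuous_onI continuous_on_hnorm)

lemma borel_measurable_hweight [measurable]: "hweight \<alpha> \<in> borel_measurable borel"
  unfolding hweight_def[abs_def] by measurable

lemma hweight_pos: "x \<noteq> 0 \<Longrightarrow> hweight \<alpha> x > 0"
  by (simp add: hweight_def)

lemma hweight_nonneg [simp]: "hweight \<alpha> x \<ge> 0"
  by (simp add: hweight_def)

lemma hball_0_eq: "hball (0::'n::finite heis) r = {x. hnorm x < r}"
proof -
  have "hmult (- x) 0 = - x" for x :: "'n heis"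
    by (simp add: hmult_def)
  moreover have "hnorm (- x) = hnorm x" for x :: "'n heis"
    by (simp add: hnorm_def)
  ultimately show ?thesis
    by (simp add: hball_def hdist_def)
qed

lemma open_hball_0: "open (hball 0 r)"
  unfolding hball_0_eq by (intro open_Collect_less continuous_intros)

lemma borel_hball_0 [measurable]: "hball 0 r \<in> sets borel"
  using open_hball_0 by (rule borel_open)

lemma compact_subset_hball_0:
  assumes "compact K"
  obtains r where "r > 0" "K \<subseteq> hball 0 r"
proof -
  have "bounded (hnorm ` K)"
    using assms by (intro compact_imp_bounded compact_continuous_image continuous_on_hnorm)
  then obtain b where "\<forall>x\<in>K. hnorm x \<le> b"
    by (auto simp: bounded_real)
  then have "K \<subseteq> hball 0 (max b 0 + 1)"
    by (force simp: hball_0_eq)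
  then show thesis
    by (intro that[of "max b 0 + 1"]) auto
qed

text \<open>
  A homogeneous norm below 1 forces every coordinate into $[-1,1]$.
\<close>

lemma bounded_hball_0_1: "bounded (hball (0::'n::finite heis) 1)"
proof -
  have "\<bar>x $ i\<bar> \<le> 1" if x: "hnorm x < 1" for x :: "'n heis" and i
  proof -
    let ?S = "\<Sum>j\<in>UNIV. (xcoord x j)\<^sup>2 + (ycoord x j)\<^sup>2"
    have "hnorm x ^ 4 \<le> 1"
      using x by (intro power_le_one) auto
    then have *: "?S\<^sup>2 + (tcoord x)\<^sup>2 \<le> 1\<^sup>2"
      by (simp add: hnorm_pow4)
    then have "(tcoord x)\<^sup>2 \<le> 1"
      using zero_le_power2[of ?S] by (simp only: power_one)
    then have t: "\<bar>tcoord x\<bar> \<le> 1"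
      by (simp add: abs_square_le_1)
    have "?S\<^sup>2 \<le> 1\<^sup>2"
      using * zero_le_power2[of "tcoord x"] by linarith
    then have "?S \<le> 1"
      by (rule power2_le_imp_le) simp
    moreover have "(xcoord x j)\<^sup>2 + (ycoord x j)\<^sup>2 \<le> ?S" for j
      by (rule member_le_sum) auto
    ultimately have "(xcoord x j)\<^sup>2 + (ycoord x j)\<^sup>2 \<le> 1" for j
      by (meson order_trans)
    then have xy: "(xcoord x j)\<^sup>2 \<le> 1" "(ycoord x j)\<^sup>2 \<le> 1" for j
      using zero_le_power2[of "xcoord x j"] zero_le_power2[of "ycoord x j"]
      by (smt (verit))+
    show ?thesis
    proof (cases i)
      case (Inl j)
      then show ?thesis
        using xy(1)[of j] by (simp add: abs_square_le_1)
    next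
      case (Inr k)
      then show ?thesis
        using xy(2) t by (cases k) (auto simp: abs_square_le_1)
    qed
  qed
  then have "hball (0::'n heis) 1 \<subseteq> cbox (\<chi> i. - 1) (\<chi> i. (1 :: real))"
    by (auto simp: hball_0_eq mem_box_cart abs_le_iff minus_le_iff)
  then show ?thesis
    by (rule bounded_subset[OF bounded_cbox])
qed

text \<open>
  The automorphic dilations of the Heisenberg group, which scale the central coordinate quadratically.
\<close>

definition hdilation :: "real \<Rightarrow> 'n::finite hmat" where
  "hdilation \<rho> = (\<chi> i j. if i = j then (if i = Inr (Inr ()) then \<rho>\<^sup>2 else \<rho>) else 0)"

lemma hdilation_mult_component:
  "(hdilation \<rho> *v x) $ i = (if i = Inr (Inr ()) then \<rho>\<^sup>2 else \<rho>) * x $ i"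
proof -
  have "(hdilation \<rho> *v x) $ i = (\<Sum>j\<in>UNIV. if j = i then (if i = Inr (Inr ()) then \<rho>\<^sup>2 else \<rho>) * x $ i else 0)"
    unfolding matrix_vector_mult_def hdilation_def vec_lambda_beta by (intro sum.cong) auto
  then show ?thesis
    by simp
qed

lemma det_hdilation: "det (hdilation \<rho> :: 'n::finite hmat) = \<rho> ^ hom_dim TYPE('n)"
proof -
  have "det (hdilation \<rho> :: 'n hmat) = (\<Prod>i\<in>(UNIV :: 'n hidx set). if i = Inr (Inr ()) then \<rho>\<^sup>2 else \<rho>)"
    by (subst det_diagonal) (auto simp: hdilation_def)
  also have "\<dots> = (\<Prod>i\<in>(UNIV - {Inr (Inr ())} :: 'n hidx set). if i = Inr (Inr ()) then \<rho>\<^sup>2 else \<rho>) * \<rho>\<^sup>2"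
    by (subst prod.remove[of UNIV "Inr (Inr ())"]) auto
  also have "(\<Prod>i\<in>(UNIV - {Inr (Inr ())} :: 'n hidx set). if i = Inr (Inr ()) then \<rho>\<^sup>2 else \<rho>)
      = (\<Prod>i\<in>(UNIV - {Inr (Inr ())} :: 'n hidx set). \<rho>)"
    by (rule prod.cong) auto
  also have "\<dots> = \<rho> ^ (2 * CARD('n))"
    by (simp add: card_Diff_singleton mult_2)
  finally show ?thesis
    by (simp add: hom_dim_def power_add power2_eq_square)
qed

lemma hnorm_hdilation:
  assumes "\<rho> \<ge> 0"
  shows "hnorm (hdilation \<rho> *v x) = \<rho> * hnorm x"
proof -
  have "(\<Sum>j\<in>UNIV. (\<rho> * xcoord x j)\<^sup>2 + (\<rho> * ycoord x j)\<^sup>2)\<^sup>2 + (\<rho>\<^sup>2 * tcoord x)\<^sup>2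
      = \<rho> ^ 4 * ((\<Sum>j\<in>UNIV. (xcoord x j)\<^sup>2 + (ycoord x j)\<^sup>2)\<^sup>2 + (tcoord x)\<^sup>2)"
    by (simp add: power_mult_distrib distrib_left[symmetric] sum_distrib_left[symmetric] power_mult[symmetric])
  then show ?thesis
    using assms by (simp add: hnorm_def hdilation_mult_component real_root_mult real_root_power_cancel)
qed

text \<open>
  Radial functions against the weight: substitute a dilation, whose determinant contributes
  $\rho^Q$ and whose effect on the weight contributes $\rho^\alpha$.
\<close>

lemma nn_integral_hweight_hdilation:
  fixes u :: "real \<Rightarrow> ennreal"
  assumes [measurable]: "u \<in> borel_measurable borel" and \<rho>: "\<rho> > 0"
  shows "(\<integral>\<^sup>+x. u (hnorm x) * ennreal (hweight \<alpha> (x::'n::finite heis)) \<partial>lborel)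
    = ennreal (\<rho> powr (real (hom_dim TYPE('n)) + \<alpha>))
      * (\<integral>\<^sup>+x. u (\<rho> * hnorm x) * ennreal (hweight \<alpha> (x::'n heis)) \<partial>lborel)"
proof -
  have det: "\<bar>det (hdilation \<rho> :: 'n hmat)\<bar> = \<rho> powr real (hom_dim TYPE('n))"
    using \<rho> by (simp add: det_hdilation powr_realpow)
  have "(\<integral>\<^sup>+x. u (hnorm x) * ennreal (hweight \<alpha> (x::'n heis)) \<partial>lborel)
      = ennreal (\<rho> powr real (hom_dim TYPE('n))) * (\<integral>\<^sup>+x. u (hnorm (hdilation \<rho> *v x))
          * ennreal (hweight \<alpha> (hdilation \<rho> *v (x::'n heis))) \<partial>lborel)"
    using \<rho> unfolding det[symmetric]
    by (intro nn_integral_matrix_vector_mult) (auto simp: det_hdilation)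
  also have "(\<integral>\<^sup>+x. u (hnorm (hdilation \<rho> *v x)) * ennreal (hweight \<alpha> (hdilation \<rho> *v (x::'n heis))) \<partial>lborel)
      = (\<integral>\<^sup>+x. ennreal (\<rho> powr \<alpha>) * (u (\<rho> * hnorm x) * ennreal (hweight \<alpha> (x::'n heis))) \<partial>lborel)"
    using \<rho> by (intro nn_integral_cong)
      (simp add: hnorm_hdilation hweight_def powr_mult ennreal_mult mult_ac)
  also have "\<dots> = ennreal (\<rho> powr \<alpha>) * (\<integral>\<^sup>+x. u (\<rho> * hnorm x) * ennreal (hweight \<alpha> (x::'n heis)) \<partial>lborel)"
    by (rule nn_integral_cmult) measurable
  finally show ?thesis
    by (simp add: powr_add ennreal_mult mult.assoc)
qed

lemma wmeasure_hball_0: "wmeasure w (hball 0 r) = (\<integral>\<^sup>+x. indicator {..<r} (hnorm x) * ennreal (w x) \<partial>lborel)"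
  unfolding wmeasure_def hball_0_eq nn_integral_completion
  by (intro nn_integral_cong) (auto simp: indicator_def)

lemma wmeasure_hball_0_scale:
  assumes "\<rho> > 0"
  shows "wmeasure (hweight \<alpha>) (hball (0::'n::finite heis) (\<rho> * r))
    = ennreal (\<rho> powr (real (hom_dim TYPE('n)) + \<alpha>)) * wmeasure (hweight \<alpha>) (hball (0::'n heis) r)"
proof -
  have "indicator {..<\<rho> * r} (\<rho> * s) = (indicator {..<r} s :: ennreal)" for s
    using assms by (simp add: indicator_def)
  then show ?thesis
    unfolding wmeasure_hball_0 using assms
    by (subst nn_integral_hweight_hdilation[OF _ assms]) auto
qed

lemma wmeasure_hball_0_pos:
  assumes "r > 0"
  shows "wmeasure (hweight \<alpha>) (hball (0::'n::finite heis) r) > 0"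
proof (rule ccontr)
  assume "\<not> ?thesis"
  then have "AE x in lborel. indicator {..<r} (hnorm x) * ennreal (hweight \<alpha> (x::'n heis)) = 0"
    by (subst (asm) wmeasure_hball_0) (simp add: nn_integral_0_iff_AE)
  moreover have "AE x in lborel. x \<noteq> (0::'n heis)"
    by (rule AE_lborel_singleton)
  ultimately have "AE x in lborel. x \<notin> hball (0::'n heis) r"
  proof eventually_elim
    case (elim x)
    then show ?case
      using hweight_pos[of x \<alpha>] by (auto simp: hball_0_eq indicator_def)
  qed
  then have "hball (0::'n heis) r \<in> null_sets lebesgue"
    by (subst completion.null_sets_iff_AE) (simp add: AE_completion_iff)
  moreover have "hball (0::'n heis) r \<noteq> {}"
    using assms by (auto simp: hball_0_eq intro!: exI[of _ 0])
  ultimately show False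
    using open_not_negligible[OF open_hball_0] by (auto simp: negligible_iff_null_sets)
qed

text \<open>
  The weighted measure of the shell $2^{-k-1} \le |x|_h < 2^{-k}$ is $q^k$ times that of the first shell,
  where $q = 2^{-(Q+\alpha)}$. The condition $-Q < \alpha$ says exactly that $q < 1$, so the shells form a
  convergent geometric series.
\<close>

lemma wmeasure_hball_0_1_finite:
  assumes \<alpha>: "- real (hom_dim TYPE('n::finite)) < \<alpha>"
  shows "wmeasure (hweight \<alpha>) (hball (0::'n heis) 1) < \<infinity>"
proof -
  define q where "q = (1/2::real) powr (real (hom_dim TYPE('n)) + \<alpha>)"
  have q: "0 < q" "q < 1"
    using \<alpha> powr_less_mono'[of "1/2" 0 "real (hom_dim TYPE('n)) + \<alpha>"] by (auto simp: q_def)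
  \<comment> \<open>the first shell, where the weight is bounded whatever the sign of \<open>\<alpha>\<close>\<close>
  define W where "W = (\<integral>\<^sup>+x. indicator {1/2..<1} (hnorm x) * ennreal (hweight \<alpha> (x::'n heis)) \<partial>lborel)"
  have W: "W < \<infinity>"
  proof -
    define c where "c = max 1 ((1/2::real) powr \<alpha>)"
    have le: "hweight \<alpha> x \<le> c" if "1/2 \<le> hnorm x" "hnorm x < 1" for x :: "'n heis"
    proof (cases "\<alpha> \<ge> 0")
      case True
      then have "hnorm x powr \<alpha> \<le> 1 powr \<alpha>"
        using that by (intro powr_mono2) auto
      then show ?thesis
        by (simp add: hweight_def c_def)
    next
      case False
      then have "hnorm x powr \<alpha> \<le> (1/2) powr \<alpha>"
        using that by (intro powr_mono2') auto
      then show ?thesis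
        by (simp add: hweight_def c_def)
    qed
    have "W \<le> (\<integral>\<^sup>+x. ennreal c * indicator (hball (0::'n heis) 1) x \<partial>lborel)"
      unfolding W_def using le
      by (intro nn_integral_mono) (auto simp: indicator_def hball_0_eq ennreal_leI)
    also have "\<dots> = ennreal c * emeasure lborel (hball (0::'n heis) 1)"
      by (rule nn_integral_cmult_indicator) simp
    also have "\<dots> < \<infinity>"
      using emeasure_bounded_finite[OF bounded_hball_0_1[where 'n='n]] by (simp add: ennreal_mult_less_top)
    finally show ?thesis .
  qed
  \<comment> \<open>the \<open>k\<close>-th shell, dilated back to the first one\<close>
  define a where "a k x = indicator {1/2..<1} (2 ^ k * hnorm x) * ennreal (hweight \<alpha> (x::'n heis))" for k :: nat and x
  have [measurable]: "a k \<in> borel_measurable borel" for k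
    unfolding a_def[abs_def] by measurable
  have a_int: "(\<integral>\<^sup>+x. a k x \<partial>lborel) = ennreal (q ^ k) * W" for k
  proof -
    have "W = ennreal ((2 ^ k) powr (real (hom_dim TYPE('n)) + \<alpha>)) * (\<integral>\<^sup>+x. a k x \<partial>lborel)"
      unfolding W_def a_def by (rule nn_integral_hweight_hdilation) auto
    moreover have "ennreal (q ^ k) * ennreal ((2 ^ k) powr (real (hom_dim TYPE('n)) + \<alpha>)) = 1"
      by (simp add: q_def ennreal_mult[symmetric] powr_realpow[symmetric] powr_powr powr_divide mult.commute
          del: powr_realpow)
    ultimately show ?thesis
      by (simp add: mult.assoc[symmetric])
  qed
  have "wmeasure (hweight \<alpha>) (hball (0::'n heis) 1) \<le> (\<integral>\<^sup>+x. (\<Sum>k. a k x) \<partial>lborel)"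
    unfolding wmeasure_hball_0
  proof (rule nn_integral_mono)
    fix x :: "'n heis"
    show "indicator {..<1} (hnorm x) * ennreal (hweight \<alpha> x) \<le> (\<Sum>k. a k x)"
    proof (cases "x = 0 \<or> hnorm x \<ge> 1")
      case True
      then have "indicator {..<1} (hnorm x) * ennreal (hweight \<alpha> x) = 0"
        by (cases "x = 0") (simp_all add: hweight_def)
      then show ?thesis
        by (simp only: zero_le)
    next
      case False
      then have x: "0 < hnorm x" "hnorm x < 1"
        by simp_all
      have "\<exists>n. 1 \<le> 2 ^ n * hnorm x"
      proof -
        obtain n where "1 / hnorm x < 2 ^ n"
          using real_arch_pow[of 2 "1 / hnorm x"] by auto
        then show ?thesis
          using x by (intro exI[of _ n]) (simp add: field_simps)
      qed
      \<comment> \<open>the shell containing \<open>x\<close> is the one just before the first dilate that leaves the unit ball\<close>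
      define n where "n = (LEAST n. 1 \<le> 2 ^ n * hnorm x)"
      have n: "1 \<le> 2 ^ n * hnorm x"
        unfolding n_def using \<open>\<exists>n. _\<close> by (rule LeastI_ex)
      obtain k where k: "n = Suc k"
        using n x by (cases n) auto
      have "2 ^ k * hnorm x < 1"
        using not_less_Least[of k "\<lambda>n. 1 \<le> 2 ^ n * hnorm x"] k by (simp add: n_def[symmetric])
      moreover have "1 / 2 \<le> 2 ^ k * hnorm x"
        using n k by simp
      ultimately have "indicator {..<1} (hnorm x) * ennreal (hweight \<alpha> x) \<le> a k x"
        using x by (simp add: a_def)
      also have "a k x \<le> (\<Sum>k. a k x)"
        using sum_le_suminf[of "\<lambda>k. a k x" "{k}"] by simp
      finally show ?thesis .
    qed
  qed
  also have "\<dots> = (\<Sum>k. ennreal (q ^ k) * W)"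
    by (subst nn_integral_suminf) (simp_all add: a_int)
  also have "\<dots> = ennreal (\<Sum>k. q ^ k) * W"
    using q by (simp add: ennreal_suminf_multc suminf_ennreal2 summable_geometric)
  also have "\<dots> < \<infinity>"
    using W by (simp add: ennreal_mult_less_top)
  finally show ?thesis .
qed

lemma wmeasure_hball_0_finite:
  assumes "- real (hom_dim TYPE('n::finite)) < \<alpha>" "r > 0"
  shows "wmeasure (hweight \<alpha>) (hball (0::'n heis) r) < \<infinity>"
  using wmeasure_hball_0_1_finite[OF assms(1)] wmeasure_hball_0_scale[OF assms(2), of \<alpha> 1, where 'n='n]
  by (simp add: ennreal_mult_less_top)

section \<open>Composition with a fixed matrix\<close>

lemma hnorm_mult_le: "ennreal (hnorm (M *v x)) \<le> hmat_norm M * ennreal (hnorm x)"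
proof (cases "x = 0")
  case False
  then have "ennreal (hnorm (M *v x)) = ennreal (hnorm (M *v x) / hnorm x) * ennreal (hnorm x)"
    by (simp add: ennreal_mult[symmetric])
  also have "\<dots> \<le> hmat_norm M * ennreal (hnorm x)"
    unfolding hmat_norm_def using False by (intro mult_right_mono SUP_upper) auto
  finally show ?thesis .
next
  case True
  then show ?thesis
    by (simp add: matrix_vector_mult_0_right)
qed

lemma matrix_inv_mult_vector:
  fixes M :: "real^'n^'n"
  assumes "det M \<noteq> 0"
  shows "matrix_inv M *v (M *v x) = x"
proof -
  have "invertible M"
    using assms by (simp add: invertible_det_nz)
  then have "M ** matrix_inv M = mat 1 \<and> matrix_inv M ** M = mat 1"
    unfolding invertible_def matrix_inv_def by (rule someI_ex)
  then show ?thesis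
    by (simp add: matrix_vector_mul_assoc)
qed

lemma mult_vector_eq_0_iff:
  fixes M :: "real^'n^'n"
  assumes "det M \<noteq> 0"
  shows "M *v x = 0 \<longleftrightarrow> x = 0"
  using matrix_inv_mult_vector[OF assms, of x] by (auto simp: matrix_vector_mult_0_right)

text \<open>
  Positivity guarantees that a ball is mapped into a ball of positive radius, on which the Morrey norm
  gives information.
\<close>

lemma hmat_norm_pos:
  fixes M :: "'n::finite hmat"
  assumes "det M \<noteq> 0"
  shows "hmat_norm M > 0"
proof (rule ccontr)
  assume "\<not> ?thesis"
  then have "ennreal (hnorm (M *v axis (Inr (Inr ())) 1)) \<le> 0"
    using hnorm_mult_le[of M "axis (Inr (Inr ())) 1"] by simp
  then have "M *v axis (Inr (Inr ())) 1 = 0"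
    using hnorm_nonneg[of "M *v axis (Inr (Inr ())) 1"] by (simp add: ennreal_eq_0_iff del: hnorm_nonneg)
  then show False
    using assms by (simp add: mult_vector_eq_0_iff axis_eq_0_iff)
qed

text \<open>
  A bound for the ratio of the weights at \<open>x\<close> and at \<open>M *v x\<close>. The sign of \<open>\<alpha>\<close> decides whether an
  upper or a lower bound for the norm of \<open>M *v x\<close> is relevant, hence which of the two matrix norms
  enters.
\<close>

definition weight_distortion :: "real \<Rightarrow> 'n::finite hmat \<Rightarrow> ennreal" where
  "weight_distortion \<alpha> M =
     (if 0 < \<alpha> then hmat_norm (matrix_inv M) epowr \<alpha> else hmat_norm M epowr (- \<alpha>))"

lemma hweight_le_weight_distortion:
  assumes M: "det M \<noteq> 0" and x: "x \<noteq> 0"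
  shows "ennreal (hweight \<alpha> x) \<le> weight_distortion \<alpha> M * ennreal (hweight \<alpha> (M *v x))"
proof -
  have Mx: "M *v x \<noteq> 0"
    using M x by (simp add: mult_vector_eq_0_iff)
  have pw: "ennreal (hnorm z) epowr a = ennreal (hnorm z powr a)" if "z \<noteq> 0" for z :: "'a heis" and a
    using that by (simp add: ennreal_epowr_pos)
  show ?thesis
  proof (cases "\<alpha> > 0")
    case True
    have "ennreal (hnorm x) \<le> hmat_norm (matrix_inv M) * ennreal (hnorm (M *v x))"
      using hnorm_mult_le[of "matrix_inv M" "M *v x"] M by (simp add: matrix_inv_mult_vector)
    then have "ennreal (hnorm x) epowr \<alpha> \<le> (hmat_norm (matrix_inv M) * ennreal (hnorm (M *v x))) epowr \<alpha>"
      using True by (intro epowr_mono) auto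
    then show ?thesis
      using True x Mx by (simp add: epowr_mult pw hweight_def weight_distortion_def)
  next
    case False
    \<comment> \<open>a negative power reverses the inequality, so the positive power \<open>- \<alpha>\<close> is compared first and then inverted\<close>
    let ?u = "hnorm x" and ?v = "hnorm (M *v x)"
    have pos: "?u > 0" "?v > 0"
      using x Mx by auto
    have "ennreal ?v epowr (- \<alpha>) \<le> (hmat_norm M * ennreal ?u) epowr (- \<alpha>)"
      using False by (intro epowr_mono hnorm_mult_le) auto
    then have *: "ennreal (?v powr - \<alpha>) \<le> hmat_norm M epowr (- \<alpha>) * ennreal (?u powr - \<alpha>)"
      using False x Mx by (simp add: epowr_mult pw)
    have "ennreal (?u powr \<alpha>) = ennreal (?v powr - \<alpha>) * ennreal (?v powr \<alpha> * ?u powr \<alpha>)"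
      using pos by (simp add: ennreal_mult[symmetric] powr_minus field_simps)
    also have "\<dots> \<le> hmat_norm M epowr (- \<alpha>) * ennreal (?u powr - \<alpha>) * ennreal (?v powr \<alpha> * ?u powr \<alpha>)"
      by (intro mult_right_mono *) auto
    also have "\<dots> = hmat_norm M epowr (- \<alpha>) * ennreal (?u powr - \<alpha> * (?v powr \<alpha> * ?u powr \<alpha>))"
      by (simp add: ennreal_mult mult.assoc)
    also have "?u powr - \<alpha> * (?v powr \<alpha> * ?u powr \<alpha>) = ?v powr \<alpha>"
      using pos by (simp add: powr_minus field_simps)
    finally show ?thesis
      using False by (simp add: hweight_def weight_distortion_def)
  qed
qed

text \<open>
  The Morrey norm is a supremum of normalised ball integrals. Undoing the normalisation is legitimate
  because the measure of the ball lies strictly between 0 and $\infty$.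
\<close>

lemma nn_integral_hball_0_le_morrey_norm:
  assumes p: "1 \<le> p" and lam: "- 1 / p \<le> lam" and r: "r > 0"
    and W: "0 < wmeasure w (hball 0 r)" "wmeasure w (hball 0 r) < \<infinity>"
  shows "(\<integral>\<^sup>+x\<in>hball 0 r. ennreal (norm (f x) powr p * w x) \<partial>lborel)
    \<le> wmeasure w (hball 0 r) epowr (1 + p * lam) * morrey_norm p lam w f epowr p"
proof -
  let ?W = "wmeasure w (hball 0 r)" and ?N = "morrey_norm p lam w f" and ?e = "1 + p * lam"
  let ?J = "\<integral>\<^sup>+x\<in>hball 0 r. ennreal (norm (f x) powr p * w x) \<partial>lborel"
  have e: "?e \<ge> 0"
    using p lam by (simp add: field_simps)
  have We: "?W epowr ?e \<noteq> 0" "?W epowr ?e \<noteq> top"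
    using W by (cases ?W; auto simp: ennreal_epowr_pos)+
  have "((1 / ?W epowr ?e) * ?J) epowr (1 / p) \<le> ?N"
    unfolding morrey_norm_def nn_integral_completion using r by (intro SUP_upper) auto
  then have "(((1 / ?W epowr ?e) * ?J) epowr (1 / p)) epowr p \<le> ?N epowr p"
    using p by (intro epowr_mono) auto
  then have "(1 / ?W epowr ?e) * ?J \<le> ?N epowr p"
    using p by (simp add: epowr_inverse_exponent)
  then have "?W epowr ?e * ((1 / ?W epowr ?e) * ?J) \<le> ?W epowr ?e * ?N epowr p"
    by (rule mult_left_mono) auto
  moreover have "?W epowr ?e * ((1 / ?W epowr ?e) * ?J) = ?J"
    using We by (simp add: mult.assoc[symmetric] ennreal_times_divide ennreal_divide_self less_top)
  ultimately show ?thesis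
    by simp
qed

lemma nn_integral_le_of_hball_0:
  assumes [measurable]: "v \<in> borel_measurable borel"
    and le: "\<And>r. r > 0 \<Longrightarrow> (\<integral>\<^sup>+x\<in>hball (0::'n::finite heis) r. v x \<partial>lborel) \<le> c"
  shows "(\<integral>\<^sup>+x. v x \<partial>lborel) \<le> c"
proof -
  have eq: "(SUP n. v x * indicator (hball 0 (real n)) x) = v x" for x
  proof (rule antisym)
    show "(SUP n. v x * indicator (hball 0 (real n)) x) \<le> v x"
      by (rule SUP_least) (simp add: indicator_def)
    obtain n where "hnorm x < real n"
      using reals_Archimedean2 by blast
    then have "v x = v x * indicator (hball 0 (real n)) x"
      by (simp add: hball_0_eq)
    also have "\<dots> \<le> (SUP n. v x * indicator (hball 0 (real n)) x)"
      by (rule SUP_upper) simp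
    finally show "v x \<le> (SUP n. v x * indicator (hball 0 (real n)) x)" .
  qed
  have "(\<integral>\<^sup>+x. v x \<partial>lborel) = (\<integral>\<^sup>+x. (SUP n. v x * indicator (hball 0 (real n)) x) \<partial>lborel)"
    by (simp only: eq)
  also have "\<dots> = (SUP n. \<integral>\<^sup>+x\<in>hball 0 (real n). v x \<partial>lborel)"
    by (rule nn_integral_monotone_convergence_SUP)
       (auto simp: incseq_def le_fun_def indicator_def hball_0_eq)
  also have "\<dots> \<le> c"
  proof (rule SUP_least)
    fix n :: nat
    have "(\<integral>\<^sup>+x\<in>hball 0 (real n). v x \<partial>lborel) \<le> (\<integral>\<^sup>+x\<in>hball 0 (real (Suc n)). v x \<partial>lborel)"
      by (intro nn_integral_mono) (auto simp: indicator_def hball_0_eq)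
    also have "\<dots> \<le> c"
      by (rule le) simp
    finally show "(\<integral>\<^sup>+x\<in>hball 0 (real n). v x \<partial>lborel) \<le> c" .
  qed
  finally show ?thesis .
qed

text \<open>
  If the norm \<open>m\<close> of \<open>M\<close> is finite, the ball of radius \<open>r\<close> is mapped into the ball of radius \<open>m * r\<close>,
  and the scaling of ball measures produces the power of \<open>m\<close>. If it is infinite, the right-hand side is
  infinite except when \<open>1 + p * lam = 0\<close> or the Morrey norm vanishes; in these two cases the Morrey norm
  bounds the integral over all balls uniformly, hence over the whole space.
\<close>

lemma nn_integral_hball_0_compose_le:
  fixes M :: "'n::finite hmat"
  assumes p: "1 \<le> p" and lam: "- 1 / p \<le> lam" and \<alpha>: "- real (hom_dim TYPE('n)) < \<alpha>"
    and r: "r > 0" and M: "det M \<noteq> 0" and f[measurable]: "f \<in> borel_measurable borel"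
  shows "ennreal \<bar>det M\<bar> * (\<integral>\<^sup>+x\<in>hball 0 r. ennreal (norm (f (M *v x)) powr p * hweight \<alpha> (M *v x)) \<partial>lborel)
    \<le> hmat_norm M epowr ((real (hom_dim TYPE('n)) + \<alpha>) * (1 + p * lam))
      * (wmeasure (hweight \<alpha>) (hball (0::'n heis) r) epowr (1 + p * lam) * morrey_norm p lam (hweight \<alpha>) f epowr p)"
    (is "?d * ?J \<le> ?A * (?W r epowr ?e * ?N epowr p)")
proof -
  define v where "v z = ennreal (norm (f z) powr p * hweight \<alpha> z)" for z
  have v[measurable]: "v \<in> borel_measurable borel"
    unfolding v_def[abs_def] by measurable
  have e: "?e \<ge> 0"
    using p lam by (simp add: field_simps)
  have W: "0 < ?W s" "?W s < \<infinity>" if "s > 0" for s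
    using wmeasure_hball_0_pos[OF that] wmeasure_hball_0_finite[OF \<alpha> that] by auto
  have ball: "(\<integral>\<^sup>+x\<in>hball 0 s. v x \<partial>lborel) \<le> ?W s epowr ?e * ?N epowr p" if "s > 0" for s
    unfolding v_def using nn_integral_hball_0_le_morrey_norm[OF p lam that W[OF that]] .
  have change: "(\<integral>\<^sup>+x. u x \<partial>lborel) = ?d * (\<integral>\<^sup>+x. u (M *v x) \<partial>lborel)" if "u \<in> borel_measurable borel" for u
    using nn_integral_matrix_vector_mult[OF M that] .
  have J: "?J = (\<integral>\<^sup>+x. v (M *v x) * indicator (hball 0 r) x \<partial>lborel)"
    by (simp add: v_def)
  show ?thesis
  proof (cases "hmat_norm M")
    case (real m)
    have m: "m > 0"
      using hmat_norm_pos[OF M] real by simp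
    have "?J \<le> (\<integral>\<^sup>+x. v (M *v x) * indicator (hball 0 (m * r)) (M *v x) \<partial>lborel)"
      unfolding J
    proof (intro nn_integral_mono mult_left_mono)
      fix x :: "'n heis"
      have "ennreal (hnorm (M *v x)) \<le> ennreal (m * hnorm x)"
        using hnorm_mult_le[of M x] real by (simp add: ennreal_mult)
      then have "hnorm (M *v x) \<le> m * hnorm x"
        using m by (simp add: ennreal_le_iff)
      moreover have "m * hnorm x < m * r" if "hnorm x < r"
        using that m by simp
      ultimately show "indicator (hball 0 r) x \<le> (indicator (hball 0 (m * r)) (M *v x) :: ennreal)"
        by (auto simp: indicator_def hball_0_eq)
    qed simp
    then have "?d * ?J \<le> ?d * (\<integral>\<^sup>+x. v (M *v x) * indicator (hball 0 (m * r)) (M *v x) \<partial>lborel)"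
      by (rule mult_left_mono) simp
    also have "\<dots> = (\<integral>\<^sup>+x\<in>hball 0 (m * r). v x \<partial>lborel)"
      by (rule change[symmetric]) measurable
    also have "\<dots> \<le> ?W (m * r) epowr ?e * ?N epowr p"
      using m r by (intro ball) simp
    also have "?W (m * r) = hmat_norm M epowr (real (hom_dim TYPE('n)) + \<alpha>) * ?W r"
      using wmeasure_hball_0_scale[OF m, of \<alpha> r] m real by (simp add: ennreal_epowr_pos)
    also have "\<dots> epowr ?e = ?A * ?W r epowr ?e"
      using e \<alpha> by (simp add: epowr_mult epowr_epowr)
    finally show ?thesis
      by (simp add: mult.assoc)
  next
    case top
    have "?d * ?J \<le> ?d * (\<integral>\<^sup>+x. v (M *v x) \<partial>lborel)"
      unfolding J by (intro mult_left_mono nn_integral_mono) (auto simp: indicator_def)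
    also have "\<dots> = (\<integral>\<^sup>+x. v x \<partial>lborel)"
      by (rule change[symmetric]) measurable
    finally have le: "?d * ?J \<le> (\<integral>\<^sup>+x. v x \<partial>lborel)" .
    show ?thesis
    proof (cases "?e = 0 \<or> ?N = 0")
      case True
      have "(\<integral>\<^sup>+x. v x \<partial>lborel) \<le> (if ?e = 0 then ?N epowr p else 0)"
      proof (rule nn_integral_le_of_hball_0[OF v])
        fix s :: real assume s: "s > 0"
        show "(\<integral>\<^sup>+x\<in>hball 0 s. v x \<partial>lborel) \<le> (if ?e = 0 then ?N epowr p else 0)"
          using ball[OF s] True p by (cases "?e = 0") (simp_all add: zero_epowr del: mult_eq_0_iff)
      qed
      also have "\<dots> \<le> ?A * (?W r epowr ?e * ?N epowr p)"
        by (cases "?e = 0") simp_all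
      finally show ?thesis
        using le by simp
    next
      case False
      then have "?A = \<infinity>"
        using e \<alpha> top by (simp add: top_epowr)
      moreover have "?W r epowr ?e * ?N epowr p \<noteq> 0"
        using W(1)[OF r] False e p by (simp add: epowr_eq_0_iff)
      ultimately show ?thesis
        by (simp add: ennreal_top_mult)
    qed
  qed
qed

text \<open>
  The previous bound combined with the distortion of the weight, after extracting \<open>p\<close>-th roots: this
  is where the integrand of $C_3(\alpha)$ comes from.
\<close>

lemma morrey_ball_norm_compose_le:
  fixes M :: "'n::finite hmat"
  assumes p: "1 \<le> p" and lam: "- 1 / p \<le> lam" and \<alpha>: "- real (hom_dim TYPE('n)) < \<alpha>"
    and r: "r > 0" and M: "det M \<noteq> 0" and f[measurable]: "f \<in> borel_measurable borel"
  shows "(\<integral>\<^sup>+x\<in>hball 0 r. ennreal (norm (f (M *v x)) powr p * hweight \<alpha> x) \<partial>lborel) epowr (1 / p)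
    \<le> (hmat_norm M epowr ((real (hom_dim TYPE('n)) + \<alpha>) * (lam + 1 / p)) / ennreal (\<bar>det M\<bar> powr (1 / p)))
      * weight_distortion \<alpha> M epowr (1 / p)
      * (wmeasure (hweight \<alpha>) (hball (0::'n heis) r) epowr (lam + 1 / p) * morrey_norm p lam (hweight \<alpha>) f)"
    (is "?X epowr (1 / p) \<le> ?A' / ?d' * ?T epowr (1 / p) * (?W epowr ?l * ?N)")
proof -
  let ?e = "1 + p * lam" and ?d = "ennreal \<bar>det M\<bar>"
  let ?A = "hmat_norm M epowr ((real (hom_dim TYPE('n)) + \<alpha>) * ?e)"
  have e: "?e \<ge> 0"
    using p lam by (simp add: field_simps)
  have el: "?e * (1 / p) = ?l"
    using p by (simp add: field_simps)
  have [measurable]: "(\<lambda>x. M *v x) \<in> borel_measurable borel"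
    by (intro borel_measurable_continuous_onI matrix_vector_mult_linear_continuous_on)
  have "?X \<le> (\<integral>\<^sup>+x. ?T * (ennreal (norm (f (M *v x)) powr p * hweight \<alpha> (M *v x)) * indicator (hball 0 r) x) \<partial>lborel)"
  proof (rule nn_integral_mono_AE)
    show "AE x in lborel. ennreal (norm (f (M *v x)) powr p * hweight \<alpha> x) * indicator (hball 0 r) x
        \<le> ?T * (ennreal (norm (f (M *v x)) powr p * hweight \<alpha> (M *v x)) * indicator (hball 0 r) x)"
      using AE_lborel_singleton[of 0]
    proof eventually_elim
      case (elim x)
      have "ennreal (norm (f (M *v x)) powr p) * ennreal (hweight \<alpha> x)
          \<le> ennreal (norm (f (M *v x)) powr p) * (?T * ennreal (hweight \<alpha> (M *v x)))"
        using M elim by (intro mult_left_mono hweight_le_weight_distortion) auto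
      then show ?case
        by (simp add: ennreal_mult indicator_def mult_ac)
    qed
  qed
  also have "\<dots> = ?T * (\<integral>\<^sup>+x\<in>hball 0 r. ennreal (norm (f (M *v x)) powr p * hweight \<alpha> (M *v x)) \<partial>lborel)"
    by (rule nn_integral_cmult) measurable
  finally have "?d * ?X \<le> ?T * (?d * (\<integral>\<^sup>+x\<in>hball 0 r. ennreal (norm (f (M *v x)) powr p * hweight \<alpha> (M *v x)) \<partial>lborel))"
    by (simp add: mult_left_mono mult.left_commute[of ?T])
  also have "\<dots> \<le> ?T * (?A * (?W epowr ?e * ?N epowr p))"
    by (intro mult_left_mono nn_integral_hball_0_compose_le p lam \<alpha> r M f) simp
  finally have "(?d * ?X) epowr (1 / p) \<le> (?T * (?A * (?W epowr ?e * ?N epowr p))) epowr (1 / p)"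
    using p by (intro epowr_mono) auto
  moreover have "?d epowr (1 / p) = ?d'"
    using p M by (simp add: ennreal_epowr)
  moreover have "?A epowr (1 / p) = ?A'"
    using p e \<alpha> by (subst epowr_epowr) (simp_all only: mult.assoc el, simp_all)
  moreover have "(?W epowr ?e) epowr (1 / p) = ?W epowr ?l"
    using p e el by (subst epowr_epowr) simp_all
  moreover have "(?N epowr p) epowr (1 / p) = ?N"
    using p by (simp add: epowr_inverse_exponent)
  ultimately have le: "?d' * ?X epowr (1 / p) \<le> ?T epowr (1 / p) * (?A' * (?W epowr ?l * ?N))"
    using p by (simp add: epowr_mult)
  have d': "?d' \<noteq> 0" "?d' \<noteq> top"
    using M by simp_all
  then have "?X epowr (1 / p) = ?X epowr (1 / p) * ?d' / ?d'"
    by (intro ennreal_mult_divide_eq[symmetric])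
  also have "\<dots> = ?d' * ?X epowr (1 / p) / ?d'"
    by (simp only: mult.commute)
  also have "\<dots> \<le> ?T epowr (1 / p) * (?A' * (?W epowr ?l * ?N)) / ?d'"
    by (rule divide_right_mono_ennreal[OF le])
  also have "\<dots> = ?A' / ?d' * ?T epowr (1 / p) * (?W epowr ?l * ?N)"
    by (simp add: divide_ennreal_def mult_ac)
  finally show ?thesis .
qed

section \<open>Measurability and Borel representatives\<close>

lemma sigma_finite_completion:
  assumes "sigma_finite_measure M"
  shows "sigma_finite_measure (completion M)"
proof -
  interpret sigma_finite_measure M by fact
  obtain A where "countable A" "A \<subseteq> sets M" "\<Union>A = space M" "\<forall>a\<in>A. emeasure M a \<noteq> \<infinity>"
    using sigma_finite_countable by blast
  then show ?thesis
    by (intro sigma_finite_measure.intro exI[of _ A]) (auto simp: emeasure_completion subset_iff)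
qed

lemma borel_measurable_completion_AE_cong:
  assumes g: "g \<in> borel_measurable (completion M)" and ae: "AE x in completion M. f x = g x"
  shows "f \<in> borel_measurable (completion M)"
proof (rule measurableI)
  fix B :: "'b set" assume "B \<in> sets borel"
  then have sets: "g -` B \<inter> space (completion M) \<in> sets (completion M)"
    by (rule measurable_sets[OF g])
  have "AE x in completion M. x \<in> g -` B \<inter> space (completion M) \<longleftrightarrow> x \<in> f -` B \<inter> space (completion M)"
    using ae by eventually_elim auto
  then show "f -` B \<inter> space (completion M) \<in> sets (completion M)"
    using sets by (rule completion.in_sets_AE) simp
qed simp

lemma ex_borel_AE_eq_lebesgue:
  fixes f :: "'a::euclidean_space \<Rightarrow> complex"
  assumes f[measurable]: "f \<in> borel_measurable lebesgue"
  obtains g where "g \<in> borel_measurable borel" "AE x in lborel. f x = g x"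
proof -
  obtain u where u: "u \<in> borel_measurable lborel" "AE x in lborel. Re (f x) = u x"
    using completion_ex_borel_measurable_real[of "\<lambda>x. Re (f x)" lborel] by auto
  obtain v where v: "v \<in> borel_measurable lborel" "AE x in lborel. Im (f x) = v x"
    using completion_ex_borel_measurable_real[of "\<lambda>x. Im (f x)" lborel] by auto
  show thesis
  proof (rule that[of "\<lambda>x. Complex (u x) (v x)"])
    show "(\<lambda>x. Complex (u x) (v x)) \<in> borel_measurable borel"
      using u(1) v(1) unfolding Complex_eq by simp
    show "AE x in lborel. f x = Complex (u x) (v x)"
      using u(2) v(2) by eventually_elim (simp add: complex_eq_iff)
  qed
qed

lemma borel_measurable_matrix_vector_mult [measurable (raw)]:
  fixes A :: "'a \<Rightarrow> real^'m^'n"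
  assumes "A \<in> borel_measurable M" "u \<in> borel_measurable M"
  shows "(\<lambda>x. A x *v u x) \<in> borel_measurable M"
  using assms
proof (rule borel_measurable_continuous_Pair)
  show "continuous_on UNIV (\<lambda>x::(real^'m^'n) \<times> (real^'m). fst x *v snd x)"
    unfolding matrix_vector_mult_def by (intro continuous_intros continuous_on_vec_lambda)
qed

lemma borel_measurable_locally_integrable:
  assumes "locally_integrable \<Phi>"
  shows "\<Phi> \<in> borel_measurable lebesgue"
proof (rule borel_measurable_LIMSEQ_metric)
  fix n :: nat
  show "(\<lambda>x. indicator (cball 0 (real n)) x *\<^sub>R \<Phi> x) \<in> borel_measurable lebesgue"
    using assms by (auto simp: locally_integrable_def set_integrable_def intro: borel_measurable_integrable)
next
  fix x :: "'a heis"
  obtain N where N: "norm x \<le> real N"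
    using real_arch_simple by blast
  have "eventually (\<lambda>n. indicator (cball 0 (real n)) x *\<^sub>R \<Phi> x = \<Phi> x) sequentially"
    using eventually_ge_at_top[of N] by eventually_elim (use N in \<open>auto simp: indicator_def\<close>)
  then show "(\<lambda>n. indicator (cball 0 (real n)) x *\<^sub>R \<Phi> x) \<longlonglongrightarrow> \<Phi> x"
    by (rule tendsto_eventually)
qed

lemma morrey_norm_cong_AE:
  assumes "AE x in lborel. f x = g x"
  shows "morrey_norm p lam w f = morrey_norm p lam w g"
proof -
  have "(\<integral>\<^sup>+x\<in>hball 0 r. ennreal (norm (f x) powr p * w x) \<partial>lborel)
      = (\<integral>\<^sup>+x\<in>hball 0 r. ennreal (norm (g x) powr p * w x) \<partial>lborel)" for r
    using assms by (intro nn_integral_cong_AE, eventually_elim) simp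
  then show ?thesis
    by (simp add: morrey_norm_def nn_integral_completion)
qed

lemma C3_eq:
  fixes A :: "'n::finite heis \<Rightarrow> 'n hmat"
  assumes p: "1 \<le> p"
  shows "C3 p lam \<Phi> A \<alpha> = (\<integral>\<^sup>+y. ennreal (norm (\<Phi> y) / hnorm y ^ hom_dim TYPE('n)) *
      (hmat_norm (A y) epowr ((real (hom_dim TYPE('n)) + \<alpha>) * (lam + 1 / p)) / ennreal (\<bar>det (A y)\<bar> powr (1 / p))) *
      weight_distortion \<alpha> (A y) epowr (1 / p) \<partial>lebesgue)"
proof -
  have "weight_distortion \<alpha> M epowr (1 / p) =
      (if 0 < \<alpha> then hmat_norm (matrix_inv M) epowr (\<alpha> / p) else hmat_norm M epowr (- \<alpha> / p))" for M :: "'n hmat"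
    using p by (simp add: weight_distortion_def epowr_epowr)
  then show ?thesis
    by (simp add: C3_def Let_def)
qed

lemma borel_measurable_fst_lborel: "fst \<in> borel_measurable (lborel \<Otimes>\<^sub>M M)"
  using measurable_fst[of lborel M] by simp

text \<open>
  Changing \<open>f\<close> on a null set \<open>N\<close> is invisible in the Hausdorff operator. For fixed \<open>y\<close> with \<open>A y\<close>
  invertible, the preimage of \<open>N\<close> under \<open>A y\<close> is null by the change of variables; Fubini exchanges
  the two almost-everywhere quantifiers.
\<close>

lemma AE_compose_matrix_eq:
  fixes A :: "'n::finite heis \<Rightarrow> 'n hmat" and \<Phi> :: "'n heis \<Rightarrow> complex"
  assumes \<Phi>[measurable]: "\<Phi> \<in> borel_measurable lebesgue" and A[measurable]: "A \<in> borel_measurable lebesgue"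
    and det: "AE y in lebesgue. \<Phi> y \<noteq> 0 \<longrightarrow> det (A y) \<noteq> 0"
    and fg: "AE x in lborel. f x = g x"
  shows "AE x in lborel. AE y in lebesgue. \<Phi> y \<noteq> 0 \<longrightarrow> f (A y *v x) = g (A y *v x)"
proof -
  interpret leb: sigma_finite_measure "lebesgue :: 'n heis measure"
    by (rule sigma_finite_completion[OF sigma_finite_lborel])
  interpret P: pair_sigma_finite "lborel :: 'n heis measure" "lebesgue :: 'n heis measure" ..
  obtain N where N: "{x. f x \<noteq> g x} \<subseteq> N" "N \<in> sets borel" "emeasure lborel N = 0"
    using AE_E[OF fg] by auto
  note [measurable] = N(2)
  have "(\<lambda>q. A (snd q) *v fst q) \<in> borel_measurable (lborel \<Otimes>\<^sub>M lebesgue)"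
    by (intro borel_measurable_matrix_vector_mult measurable_compose[OF measurable_snd A] borel_measurable_fst_lborel)
  moreover have "(\<lambda>q. \<Phi> (snd q)) \<in> borel_measurable ((lborel :: 'n heis measure) \<Otimes>\<^sub>M lebesgue)"
    by (rule measurable_compose[OF measurable_snd \<Phi>])
  ultimately have pred: "Measurable.pred (lborel \<Otimes>\<^sub>M lebesgue) (\<lambda>q. \<Phi> (snd q) \<noteq> 0 \<longrightarrow> A (snd q) *v fst q \<notin> N)"
    by measurable
  have "AE y in lebesgue. AE x in lborel. \<Phi> y \<noteq> 0 \<longrightarrow> A y *v x \<notin> N"
    using det
  proof eventually_elim
    case (elim y)
    show ?case
    proof (cases "\<Phi> y = 0")
      case False
      with elim have d: "det (A y) \<noteq> 0" by simp
      have "ennreal \<bar>det (A y)\<bar> * (\<integral>\<^sup>+x. indicator N (A y *v x) \<partial>lborel) = (\<integral>\<^sup>+x. indicator N x \<partial>lborel)"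
        by (rule nn_integral_matrix_vector_mult[OF d, symmetric]) measurable
      then have "(\<integral>\<^sup>+x. indicator N (A y *v x) \<partial>lborel) = 0"
        using d N by simp
      then have "AE x in lborel. (indicator N (A y *v x) :: ennreal) = 0"
        by (subst (asm) nn_integral_0_iff_AE) measurable
      then show ?thesis
        by eventually_elim (simp add: indicator_eq_0_iff)
    qed simp
  qed
  then have "AE x in lborel. AE y in lebesgue. \<Phi> y \<noteq> 0 \<longrightarrow> A y *v x \<notin> N"
    by (subst P.AE_commute) (use pred in \<open>simp_all add: pred_def\<close>)
  then show ?thesis
  proof eventually_elim
    case (elim x)
    then show ?case
      by eventually_elim (use N(1) in auto)
  qed
qed

section \<open>The bound for the Hausdorff operator\<close>

definition hausdorff_majorant ::
    "('n::finite heis \<Rightarrow> complex) \<Rightarrow> ('n heis \<Rightarrow> 'n hmat) \<Rightarrow> ('n heis \<Rightarrow> complex) \<Rightarrow> 'n heis \<Rightarrow> ennreal" where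
  "hausdorff_majorant \<Phi> A f x = (\<integral>\<^sup>+y. ennreal (norm (hausdorff_integrand \<Phi> A f x y)) \<partial>lebesgue)"

lemma borel_measurable_hausdorff_integrand:
  fixes A :: "'n::finite heis \<Rightarrow> 'n hmat"
  assumes [measurable]: "\<Phi> \<in> borel_measurable lebesgue" "A \<in> borel_measurable lebesgue" "f \<in> borel_measurable borel"
  shows "(\<lambda>(x, y). hausdorff_integrand \<Phi> A f x y) \<in> borel_measurable (lborel \<Otimes>\<^sub>M lebesgue)"
proof -
  have [measurable]: "hnorm \<in> borel_measurable (lebesgue :: 'n heis measure)"
    using borel_measurable_hnorm by (simp add: measurable_completion)
  note [measurable] = borel_measurable_fst_lborel
  show ?thesis
    unfolding hausdorff_integrand_def by measurable
qed

lemma norm_hausdorff_integrand: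
  fixes A :: "'n::finite heis \<Rightarrow> 'n hmat"
  shows "ennreal (norm (hausdorff_integrand \<Phi> A f x y))
    = ennreal (norm (\<Phi> y) / hnorm y ^ hom_dim TYPE('n)) * ennreal (norm (f (A y *v x)))"
  by (simp add: hausdorff_integrand_def norm_mult norm_divide norm_power ennreal_mult[symmetric])

text \<open>
  Minkowski's integral inequality moves the weighted $L^p$ norm over the ball inside the integral in \<open>y\<close>,
  where the bound for a fixed matrix applies.
\<close>

lemma hausdorff_majorant_ball_bound:
  fixes A :: "'n::finite heis \<Rightarrow> 'n hmat"
  assumes p: "1 \<le> p" and lam: "- 1 / p \<le> lam" and \<alpha>: "- real (hom_dim TYPE('n)) < \<alpha>" and r: "r > 0"
    and \<Phi>[measurable]: "\<Phi> \<in> borel_measurable lebesgue" and A[measurable]: "A \<in> borel_measurable lebesgue"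
    and det: "AE y in lebesgue. \<Phi> y \<noteq> 0 \<longrightarrow> det (A y) \<noteq> 0"
    and f[measurable]: "f \<in> borel_measurable borel" and fin: "morrey_norm p lam (hweight \<alpha>) f < \<infinity>"
  shows "(\<integral>\<^sup>+x\<in>hball 0 r. hausdorff_majorant \<Phi> A f x epowr p * ennreal (hweight \<alpha> x) \<partial>lborel) epowr (1 / p)
    \<le> wmeasure (hweight \<alpha>) (hball (0::'n heis) r) epowr (lam + 1 / p) * morrey_norm p lam (hweight \<alpha>) f * C3 p lam \<Phi> A \<alpha>"
    (is "?L \<le> ?c * _")
proof -
  define D where "D = density lborel (\<lambda>x::'n heis. ennreal (hweight \<alpha> x) * indicator (hball 0 r) x)"
  let ?F = "\<lambda>x y. ennreal (norm (hausdorff_integrand \<Phi> A f x y))"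
  let ?a = "\<lambda>y::'n heis. norm (\<Phi> y) / hnorm y ^ hom_dim TYPE('n)"
  define k where "k y = ennreal (?a y) *
      (hmat_norm (A y) epowr ((real (hom_dim TYPE('n)) + \<alpha>) * (lam + 1 / p)) / ennreal (\<bar>det (A y)\<bar> powr (1 / p))) *
      weight_distortion \<alpha> (A y) epowr (1 / p)" for y
  have fin_W: "wmeasure (hweight \<alpha>) (hball (0::'n heis) r) < \<infinity>"
    by (rule wmeasure_hball_0_finite[OF \<alpha> r])
  have D_int: "(\<integral>\<^sup>+x. u x \<partial>D) = (\<integral>\<^sup>+x\<in>hball 0 r. u x * ennreal (hweight \<alpha> x) \<partial>lborel)"
    if "u \<in> borel_measurable borel" for u
    using that unfolding D_def by (subst nn_integral_density) (auto intro!: nn_integral_cong simp: mult_ac)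
  have "sigma_finite_measure D"
  proof -
    have "emeasure D (space D) = (\<integral>\<^sup>+x. 1 \<partial>D)"
      by simp
    also have "\<dots> = wmeasure (hweight \<alpha>) (hball (0::'n heis) r)"
      by (subst D_int) (simp_all add: wmeasure_def nn_integral_completion)
    finally have "finite_measure D"
      using fin_W by (intro finite_measureI) auto
    then show ?thesis
      by (rule finite_measure.axioms(1))
  qed
  moreover have sf: "sigma_finite_measure (lebesgue :: 'n heis measure)"
    by (rule sigma_finite_completion[OF sigma_finite_lborel])
  moreover have F: "(\<lambda>(x, y). ?F x y) \<in> borel_measurable (lborel \<Otimes>\<^sub>M lebesgue)"
    using borel_measurable_hausdorff_integrand[OF \<Phi> A f] by (simp add: case_prod_beta')
  moreover have "sets (D \<Otimes>\<^sub>M lebesgue) = sets ((lborel :: 'n heis measure) \<Otimes>\<^sub>M (lebesgue :: 'n heis measure))"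
    by (rule sets_pair_measure_cong) (simp_all add: D_def)
  ultimately have M: "(\<integral>\<^sup>+x. (\<integral>\<^sup>+y. ?F x y \<partial>lebesgue) epowr p \<partial>D) epowr (1 / p)
      \<le> (\<integral>\<^sup>+y. (\<integral>\<^sup>+x. ?F x y epowr p \<partial>D) epowr (1 / p) \<partial>lebesgue)"
    using p by (intro Minkowski_nn_integral) (simp_all cong: measurable_cong_sets)
  have maj[measurable]: "hausdorff_majorant \<Phi> A f \<in> borel_measurable borel"
    using sigma_finite_measure.borel_measurable_nn_integral[OF sf F]
    by (simp add: hausdorff_majorant_def[abs_def])
  have "(\<integral>\<^sup>+x. (\<integral>\<^sup>+y. ?F x y \<partial>lebesgue) epowr p \<partial>D)
      = (\<integral>\<^sup>+x\<in>hball 0 r. hausdorff_majorant \<Phi> A f x epowr p * ennreal (hweight \<alpha> x) \<partial>lborel)"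
    unfolding hausdorff_majorant_def[symmetric] by (intro D_int) measurable
  then have "?L \<le> (\<integral>\<^sup>+y. (\<integral>\<^sup>+x. ?F x y epowr p \<partial>D) epowr (1 / p) \<partial>lebesgue)"
    using M by simp
  also have "\<dots> \<le> (\<integral>\<^sup>+y. ?c * k y \<partial>lebesgue)"
  proof (rule nn_integral_mono_AE)
    show "AE y in lebesgue. (\<integral>\<^sup>+x. ?F x y epowr p \<partial>D) epowr (1 / p) \<le> ?c * k y"
      using det
    proof eventually_elim
      case (elim y)
      have [measurable]: "(\<lambda>x. A y *v x) \<in> borel_measurable borel"
        by measurable
      have "(\<integral>\<^sup>+x. ?F x y epowr p \<partial>D)
          = (\<integral>\<^sup>+x. ennreal (?a y) epowr p * ennreal (norm (f (A y *v x)) powr p) \<partial>D)"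
        using p by (intro nn_integral_cong) (simp add: norm_hausdorff_integrand epowr_mult ennreal_epowr)
      also have "\<dots> = ennreal (?a y) epowr p * (\<integral>\<^sup>+x. ennreal (norm (f (A y *v x)) powr p) \<partial>D)"
        by (rule nn_integral_cmult) (simp add: D_def)
      also have "(\<integral>\<^sup>+x. ennreal (norm (f (A y *v x)) powr p) \<partial>D)
          = (\<integral>\<^sup>+x\<in>hball 0 r. ennreal (norm (f (A y *v x)) powr p * hweight \<alpha> x) \<partial>lborel)" (is "_ = ?X")
        by (subst D_int) (simp_all add: ennreal_mult)
      finally have eq: "(\<integral>\<^sup>+x. ?F x y epowr p \<partial>D) epowr (1 / p) = ennreal (?a y) * ?X epowr (1 / p)"
        using p by (simp add: epowr_mult epowr_inverse_exponent)
      show ?case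
      proof (cases "\<Phi> y = 0")
        case False
        with elim have "det (A y) \<noteq> 0" by simp
        from morrey_ball_norm_compose_le[OF p lam \<alpha> r this f]
        have "ennreal (?a y) * ?X epowr (1 / p) \<le> ennreal (?a y) *
            ((hmat_norm (A y) epowr ((real (hom_dim TYPE('n)) + \<alpha>) * (lam + 1 / p)) / ennreal (\<bar>det (A y)\<bar> powr (1 / p)))
              * weight_distortion \<alpha> (A y) epowr (1 / p) * ?c)"
          by (intro mult_left_mono) auto
        also have "\<dots> = ?c * k y"
          unfolding k_def by (simp only: mult_ac)
        finally show ?thesis
          unfolding eq .
      qed (simp add: eq)
    qed
  qed
  also have "\<dots> \<le> ?c * (\<integral>\<^sup>+y. k y \<partial>lebesgue)"
    using fin fin_W p lam
    by (intro nn_integral_cmult_le) (auto simp: ennreal_mult_less_top less_top epowr_def)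
  also have "(\<integral>\<^sup>+y. k y \<partial>lebesgue) = C3 p lam \<Phi> A \<alpha>"
    unfolding C3_eq[OF p] k_def ..
  finally show ?thesis .
qed

theorem theorem1p3:
  fixes p lam \<alpha> :: real
  assumes "1 \<le> p" and "- 1 / p \<le> lam" and "lam < 0"
    and "- real (hom_dim TYPE('n::finite)) < \<alpha>"
  shows "\<exists>C::real. C > 0 \<and>
    (\<forall>(\<Phi> :: 'n heis \<Rightarrow> complex) (A :: 'n heis \<Rightarrow> 'n hmat) (f :: 'n heis \<Rightarrow> complex).
       locally_integrable \<Phi> \<longrightarrow>
       A \<in> borel_measurable lebesgue \<longrightarrow>
       (AE y in lebesgue. \<Phi> y \<noteq> 0 \<longrightarrow> det (A y) \<noteq> 0) \<longrightarrow>
       f \<in> central_morrey p lam (hweight \<alpha>) \<longrightarrow>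
         morrey_norm p lam (hweight \<alpha>) (hausdorff_op \<Phi> A f)
           \<le> ennreal C * C3 p lam \<Phi> A \<alpha> * morrey_norm p lam (hweight \<alpha>) f \<and>
         (C3 p lam \<Phi> A \<alpha> < \<infinity> \<longrightarrow>
            (AE x in lebesgue. integrable lebesgue (hausdorff_integrand \<Phi> A f x)) \<and>
            hausdorff_op \<Phi> A f \<in> central_morrey p lam (hweight \<alpha>)))"
proof (intro exI[of _ 1] conjI[OF zero_less_one] allI impI)
  fix \<Phi> :: "'n heis \<Rightarrow> complex" and A :: "'n heis \<Rightarrow> 'n hmat" and f :: "'n heis \<Rightarrow> complex"
  assume li: "locally_integrable \<Phi>" and A[measurable]: "A \<in> borel_measurable lebesgue"
    and det: "AE y in lebesgue. \<Phi> y \<noteq> 0 \<longrightarrow> det (A y) \<noteq> 0"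
    and fM: "f \<in> central_morrey p lam (hweight \<alpha>)"
  note p = assms(1) and lam = assms(2) and \<alpha> = assms(4)
  let ?W = "\<lambda>r. wmeasure (hweight \<alpha>) (hball (0::'n heis) r)"
  let ?H = "hausdorff_op \<Phi> A f"
  let ?N = "morrey_norm p lam (hweight \<alpha>) f" and ?C = "C3 p lam \<Phi> A \<alpha>"
  have \<Phi>[measurable]: "\<Phi> \<in> borel_measurable lebesgue"
    using li by (rule borel_measurable_locally_integrable)
  have f_meas: "f \<in> borel_measurable lebesgue" and N: "?N < \<infinity>"
    using fM by (auto simp: central_morrey_def Lp_loc_def)
  obtain g where g[measurable]: "g \<in> borel_measurable borel" and fg: "AE x in lborel. f x = g x"
    using ex_borel_AE_eq_lebesgue[OF f_meas] .
  have Ng: "morrey_norm p lam (hweight \<alpha>) g = ?N"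
    using morrey_norm_cong_AE[OF fg] by simp
  interpret leb: sigma_finite_measure "lebesgue :: 'n heis measure"
    by (rule sigma_finite_completion[OF sigma_finite_lborel])
  have int_meas: "(\<lambda>(x, y). hausdorff_integrand \<Phi> A g x y) \<in> borel_measurable (lborel \<Otimes>\<^sub>M lebesgue)"
    by (rule borel_measurable_hausdorff_integrand[OF \<Phi> A g])
  have g_sec: "hausdorff_integrand \<Phi> A g x \<in> borel_measurable lebesgue" for x
    using measurable_Pair2[OF int_meas, of x] by simp
  have Hg_meas: "hausdorff_op \<Phi> A g \<in> borel_measurable lborel"
    unfolding hausdorff_op_def[abs_def] by (rule leb.borel_measurable_lebesgue_integral[OF int_meas])
  have maj_meas[measurable]: "hausdorff_majorant \<Phi> A g \<in> borel_measurable borel"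
    using leb.borel_measurable_nn_integral[of "\<lambda>x y. ennreal (norm (hausdorff_integrand \<Phi> A g x y))" lborel] int_meas
    by (simp add: hausdorff_majorant_def[abs_def] case_prod_beta')

  \<comment> \<open>for almost every \<open>x\<close> the Borel representative \<open>g\<close> gives the same integrand as \<open>f\<close>\<close>
  have good: "AE x in lborel. AE y in lebesgue. hausdorff_integrand \<Phi> A f x y = hausdorff_integrand \<Phi> A g x y"
    using AE_compose_matrix_eq[OF \<Phi> A det fg]
  proof eventually_elim
    case (elim x)
    then show ?case
      by eventually_elim (auto simp: hausdorff_integrand_def)
  qed
  have f_sec: "hausdorff_integrand \<Phi> A f x \<in> borel_measurable lebesgue"
    if "AE y in lebesgue. hausdorff_integrand \<Phi> A f x y = hausdorff_integrand \<Phi> A g x y" for x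
    using borel_measurable_completion_AE_cong[OF g_sec that] .
  have Hfg: "AE x in lborel. ?H x = hausdorff_op \<Phi> A g x"
    using good unfolding hausdorff_op_def
    by eventually_elim (intro integral_cong_AE f_sec g_sec)
  have H_meas: "?H \<in> borel_measurable lebesgue"
    by (rule borel_measurable_completion_AE_cong[OF measurable_completion[OF Hg_meas] AE_completion[OF Hfg]])
  have norm_g: "ennreal (norm (hausdorff_op \<Phi> A g x)) \<le> hausdorff_majorant \<Phi> A g x" for x
  proof (cases "integrable lebesgue (hausdorff_integrand \<Phi> A g x)")
    case True
    then show ?thesis
      unfolding hausdorff_op_def hausdorff_majorant_def by (rule integral_norm_bound_ennreal)
  next
    case False
    then show ?thesis
      by (simp add: hausdorff_op_def not_integrable_integral_eq)
  qed
  have W: "0 < ?W r" "?W r < \<infinity>" if "r > 0" for r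
    using wmeasure_hball_0_pos[OF that] wmeasure_hball_0_finite[OF \<alpha> that] by auto
  have ball: "(\<integral>\<^sup>+x\<in>hball 0 r. hausdorff_majorant \<Phi> A g x epowr p * ennreal (hweight \<alpha> x) \<partial>lborel) epowr (1 / p)
      \<le> ?W r epowr (lam + 1 / p) * ?N * ?C" if "r > 0" for r
    using hausdorff_majorant_ball_bound[OF p lam \<alpha> that \<Phi> A det g] N unfolding Ng by simp

  have bound: "morrey_norm p lam (hweight \<alpha>) ?H \<le> ?C * ?N"
    unfolding morrey_norm_def[of _ _ _ ?H] nn_integral_completion
  proof (rule SUP_least)
    fix r :: real assume "r \<in> {0<..}"
    then have r: "r > 0" by simp
    let ?e = "1 + p * lam"
    let ?V = "1 / ?W r epowr ?e"
    have e: "?e \<ge> 0"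
      using p lam by (simp add: field_simps)
    have We: "?W r epowr ?e \<noteq> 0" "?W r epowr ?e \<noteq> top"
      using W[OF r] by (cases "?W r"; auto simp: ennreal_epowr_pos)+
    have "(\<integral>\<^sup>+x\<in>hball 0 r. ennreal (norm (?H x) powr p * hweight \<alpha> x) \<partial>lborel)
        \<le> (\<integral>\<^sup>+x\<in>hball 0 r. hausdorff_majorant \<Phi> A g x epowr p * ennreal (hweight \<alpha> x) \<partial>lborel)"
    proof (rule nn_integral_mono_AE)
      show "AE x in lborel. ennreal (norm (?H x) powr p * hweight \<alpha> x) * indicator (hball 0 r) x
          \<le> hausdorff_majorant \<Phi> A g x epowr p * ennreal (hweight \<alpha> x) * indicator (hball 0 r) x"
        using Hfg
      proof eventually_elim
        case (elim x)
        have "ennreal (norm (?H x)) epowr p \<le> hausdorff_majorant \<Phi> A g x epowr p"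
          unfolding elim using p by (intro epowr_mono norm_g) auto
        then show ?case
          using p by (simp add: ennreal_epowr ennreal_mult mult_right_mono)
      qed
    qed
    then have "(?V * (\<integral>\<^sup>+x\<in>hball 0 r. ennreal (norm (?H x) powr p * hweight \<alpha> x) \<partial>lborel)) epowr (1 / p)
        \<le> (?V * (\<integral>\<^sup>+x\<in>hball 0 r. hausdorff_majorant \<Phi> A g x epowr p * ennreal (hweight \<alpha> x) \<partial>lborel)) epowr (1 / p)"
      using p by (intro epowr_mono mult_left_mono) auto
    also have "\<dots> \<le> ?V epowr (1 / p) * (?W r epowr (lam + 1 / p) * ?N * ?C)"
      using p ball[OF r] by (simp add: epowr_mult mult_left_mono)
    also have "?W r epowr (lam + 1 / p) = (?W r epowr ?e) epowr (1 / p)"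
      using p e by (subst epowr_epowr) (simp_all add: field_simps)
    also have "?V epowr (1 / p) * ((?W r epowr ?e) epowr (1 / p) * ?N * ?C)
        = (?V * ?W r epowr ?e) epowr (1 / p) * (?C * ?N)"
      using p by (simp add: epowr_mult mult_ac)
    also have "?V * ?W r epowr ?e = 1"
      using We by (simp add: ennreal_divide_times ennreal_divide_self less_top)
    finally show "(?V * (\<integral>\<^sup>+x\<in>hball 0 r. ennreal (norm (?H x) powr p * hweight \<alpha> x) \<partial>lborel)) epowr (1 / p) \<le> ?C * ?N"
      using ennreal_epowr_pos[of 1 "1 / p"] by simp
  qed
  have finite_case: "(AE x in lebesgue. integrable lebesgue (hausdorff_integrand \<Phi> A f x)) \<and>
      ?H \<in> central_morrey p lam (hweight \<alpha>)" if C: "?C < \<infinity>"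
  proof
    \<comment> \<open>the weighted integral of the \<open>p\<close>-th power is finite on every ball, and the weight is positive almost everywhere\<close>
    have maj_fin: "AE x in lborel. hausdorff_majorant \<Phi> A g x \<noteq> top"
    proof -
      have "AE x in lborel. x \<in> hball 0 (real (Suc n)) \<longrightarrow> hausdorff_majorant \<Phi> A g x \<noteq> top" for n
      proof -
        let ?J = "\<integral>\<^sup>+x\<in>hball 0 (real (Suc n)). hausdorff_majorant \<Phi> A g x epowr p * ennreal (hweight \<alpha> x) \<partial>lborel"
        have "?J epowr (1 / p) < top"
          using ball[of "real (Suc n)"] W(2)[of "real (Suc n)"] N C p lam
          by (intro le_less_trans[OF ball]) (auto simp: ennreal_mult_less_top less_top epowr_def)
        then have "?J \<noteq> \<infinity>"
          using p by (auto simp: top_epowr)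
        then have "AE x in lborel. hausdorff_majorant \<Phi> A g x epowr p * ennreal (hweight \<alpha> x) * indicator (hball 0 (real (Suc n))) x \<noteq> \<infinity>"
          by (intro nn_integral_noteq_infinite) measurable
        moreover have "AE x in lborel. x \<noteq> (0 :: 'n heis)"
          by (rule AE_lborel_singleton)
        ultimately show ?thesis
        proof eventually_elim
          case (elim x)
          then show ?case
            using p hweight_pos[of x \<alpha>] by (auto simp: top_epowr ennreal_top_mult)
        qed
      qed
      then have "AE x in lborel. \<forall>n. x \<in> hball 0 (real (Suc n)) \<longrightarrow> hausdorff_majorant \<Phi> A g x \<noteq> top"
        by (intro AE_all_countable[THEN iffD2] allI)
      then show ?thesis
      proof eventually_elim
        case (elim x)
        obtain n where "hnorm x < real n"
          using reals_Archimedean2 by blast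
        then have "x \<in> hball 0 (real (Suc n))"
          by (simp add: hball_0_eq)
        with elim show ?case
          by blast
      qed
    qed
    have "AE x in lborel. integrable lebesgue (hausdorff_integrand \<Phi> A f x)"
      using maj_fin good
    proof eventually_elim
      case (elim x)
      have "integrable lebesgue (hausdorff_integrand \<Phi> A g x)"
        using elim(1) by (intro integrableI_bounded g_sec) (simp add: hausdorff_majorant_def less_top)
      then show ?case
        using integrable_cong_AE[OF f_sec[OF elim(2)] g_sec elim(2)] by simp
    qed
    then show "AE x in lebesgue. integrable lebesgue (hausdorff_integrand \<Phi> A f x)"
      by (rule AE_completion)
    have fin: "morrey_norm p lam (hweight \<alpha>) ?H < \<infinity>"
      using bound C N by (auto simp: ennreal_mult_less_top intro: le_less_trans)
    have "(\<integral>\<^sup>+x\<in>K. ennreal (norm (?H x) powr p * hweight \<alpha> x) \<partial>lebesgue) < \<infinity>" if K: "compact K" for K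
    proof -
      obtain r where r: "r > 0" "K \<subseteq> hball 0 r"
        using compact_subset_hball_0[OF K] .
      have "(\<integral>\<^sup>+x\<in>K. ennreal (norm (?H x) powr p * hweight \<alpha> x) \<partial>lebesgue)
          \<le> (\<integral>\<^sup>+x\<in>hball 0 r. ennreal (norm (?H x) powr p * hweight \<alpha> x) \<partial>lborel)"
        unfolding nn_integral_completion using r(2)
        by (intro nn_integral_mono) (auto simp: indicator_def)
      also have "\<dots> \<le> ?W r epowr (1 + p * lam) * morrey_norm p lam (hweight \<alpha>) ?H epowr p"
        by (rule nn_integral_hball_0_le_morrey_norm[OF p lam r(1) W[OF r(1)]])
      also have "\<dots> < \<infinity>"
      proof -
        have "morrey_norm p lam (hweight \<alpha>) ?H epowr p \<noteq> top"
          using fin p by (simp add: epowr_eq_top_iff)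
        moreover have "?W r epowr (1 + p * lam) \<noteq> top"
          using W[OF r(1)] by (cases "?W r") (auto simp: ennreal_epowr_pos)
        ultimately show ?thesis
          by (simp add: ennreal_mult_less_top less_top)
      qed
      finally show ?thesis .
    qed
    then show "?H \<in> central_morrey p lam (hweight \<alpha>)"
      using fin H_meas by (simp add: central_morrey_def Lp_loc_def)
  qed
  show "morrey_norm p lam (hweight \<alpha>) ?H \<le> ennreal 1 * ?C * ?N \<and>
      (?C < \<infinity> \<longrightarrow> (AE x in lebesgue. integrable lebesgue (hausdorff_integrand \<Phi> A f x)) \<and>
        ?H \<in> central_morrey p lam (hweight \<alpha>))"
    using bound finite_case by simp
qed

end
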